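(* Let $G=T\times U$ be a connected nilpotent algebraic group over $\mathbb{C}$, where $T$ is a torus and $U$ is a unipotent group, with Lie algebras $\mathfrak{t}=\mathrm{Lie}(T)$, $\mathfrak{u}=\mathrm{Lie}(U)$ and $\mathfrak{g}=\mathrm{Lie}(G)=\mathfrak{t}\oplus\mathfrak{u}$ (a direct sum of Lie algebras, with $\mathfrak{t}$ abelian and $\mathfrak{u}$ nilpotent). Then every solution to the classical Yang–Baxter equation in $\wedge^2\mathfrak{g}$ has the form $s+(w-w_{21})+r$, where $s\in\wedge^2\mathfrak{t}$ is arbitrary, $r$ is a solution to the classical Yang–Baxter equation in $\wedge^2\mathfrak{u}$, and $w=\sum t_i\otimes u_i\in\mathfrak{t}\otimes\mathfrak{u}$, where $\{t_i\}$ is a basis of $\mathfrak{t}$, and $u_i$ are some elements of $\mathfrak{u}$ such that $[u_i\otimes1+1\otimes u_i,r]=0$ for every $i$.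
   Context: An element $r\in\wedge^2\mathfrak{g}$ is a solution to the classical Yang–Baxter equation if $[r_{12},r_{13}]+[r_{12},r_{23}]+[r_{13},r_{23}]=0$ in $\mathfrak{g}^{\otimes3}$ (computed in $U(\mathfrak{g})^{\otimes3}$). For $w=\sum t_i\otimes u_i$, $w_{21}=\sum u_i\otimes t_i$; elements of $\wedge^2\mathfrak{g}$ are regarded as skew-symmetric tensors in $\mathfrak{g}\otimes\mathfrak{g}$. The word "arbitrary" for $s$ means that no condition is imposed on $s$. *)

theory Defs
  imports "HOL-Analysis.Analysis" "HOL-Algebra.Generated_Groups"
begin

section \<open>Complex matrices\<close>

text \<open>The library only scales matrices over \<open>\<complex>\<close> by real numbers; this is the complex scaling.\<close>

definition cscale :: "complex \<Rightarrow> complex^'n^'m \<Rightarrow> complex^'n^'m" (infixr "*\<^sub>M" 75)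
  where "c *\<^sub>M A = (\<chi> i j. c * A $ i $ j)"

interpretation cmat: vector_space "cscale :: complex \<Rightarrow> complex^'n^'m \<Rightarrow> complex^'n^'m"
  by unfold_locales (simp_all add: cscale_def vec_eq_iff algebra_simps)

definition commutator :: "complex^'n^'n \<Rightarrow> complex^'n^'n \<Rightarrow> complex^'n^'n"
  where "commutator A B = A ** B - B ** A"

definition GL :: "(complex^'n^'n) monoid"
  where "GL = \<lparr>carrier = {A. invertible A}, mult = (**), one = mat 1\<rparr>"

lemma group_GL: "group (GL :: (complex^'n^'n) monoid)"
proof (rule groupI)
  fix A :: "complex^'n^'n" assume "A \<in> carrier GL"
  then obtain B where "A ** B = mat 1" "B ** A = mat 1"
    by (auto simp: GL_def invertible_def)
  then show "\<exists>B\<in>carrier GL. B \<otimes>\<^bsub>GL\<^esub> A = \<one>\<^bsub>GL\<^esub>"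
    by (auto simp: GL_def invertible_def)
next
  fix A B :: "complex^'n^'n" assume "A \<in> carrier GL" "B \<in> carrier GL"
  then show "A \<otimes>\<^bsub>GL\<^esub> B \<in> carrier GL"
    by (simp add: GL_def invertible_mult)
next
  show "\<one>\<^bsub>GL\<^esub> \<in> carrier (GL :: (complex^'n^'n) monoid)"
    by (auto simp: GL_def invertible_def intro: exI[of _ "mat 1"])
qed (simp_all add: GL_def matrix_mul_assoc)

section \<open>Regular functions and linear algebraic groups\<close>

text \<open>The \<open>\<complex>\<close>-algebra of functions generated by \<open>X\<close>.\<close>

inductive_set function_algebra :: "('a \<Rightarrow> complex) set \<Rightarrow> ('a \<Rightarrow> complex) set"
  for X :: "('a \<Rightarrow> complex) set" where
  const: "(\<lambda>_. c) \<in> function_algebra X"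
| gen: "f \<in> X \<Longrightarrow> f \<in> function_algebra X"
| add: "f \<in> function_algebra X \<Longrightarrow> g \<in> function_algebra X \<Longrightarrow> (\<lambda>x. f x + g x) \<in> function_algebra X"
| mult: "f \<in> function_algebra X \<Longrightarrow> g \<in> function_algebra X \<Longrightarrow> (\<lambda>x. f x * g x) \<in> function_algebra X"

text \<open>The coordinate ring \<open>\<complex>[GL\<^sub>n] = \<complex>[x\<^sub>i\<^sub>j, 1/det]\<close>. The values of its elements
  outside \<open>GL\<^sub>n\<close> are irrelevant.\<close>

definition regular_GL :: "(complex^'n^'n \<Rightarrow> complex) set"
  where "regular_GL = function_algebra
    ({f. \<exists>i j. f = (\<lambda>A. A $ i $ j)} \<union> {\<lambda>A. inverse (det A)})"

text \<open>\<open>f\<close> is a regular map from \<open>X\<close>: pulling back an element of \<open>R'\<close> agrees on \<open>X\<close> with an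
  element of \<open>R\<close>, where \<open>R\<close> and \<open>R'\<close> restrict to the coordinate rings of source and target.\<close>

definition regular_map :: "'a set \<Rightarrow> ('a \<Rightarrow> complex) set \<Rightarrow> ('b \<Rightarrow> complex) set \<Rightarrow> ('a \<Rightarrow> 'b) \<Rightarrow> bool"
  where "regular_map X R R' f \<longleftrightarrow> (\<forall>h\<in>R'. \<exists>g\<in>R. \<forall>x\<in>X. h (f x) = g x)"

definition zariski_closed :: "(complex^'n^'n) set \<Rightarrow> bool"
  where "zariski_closed S \<longleftrightarrow>
    (\<exists>F \<subseteq> regular_GL. S = {A \<in> carrier GL. \<forall>f\<in>F. f A = 0})"

definition linear_algebraic_group :: "(complex^'n^'n) set \<Rightarrow> bool"
  where "linear_algebraic_group G \<longleftrightarrow> subgroup G GL \<and> zariski_closed G"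

text \<open>For closed \<open>G\<close>, the closed subsets of \<open>G\<close> are the Zariski closed sets contained in \<open>G\<close>.\<close>

definition zariski_connected :: "(complex^'n^'n) set \<Rightarrow> bool"
  where "zariski_connected G \<longleftrightarrow>
    (\<nexists>A B. zariski_closed A \<and> zariski_closed B \<and> A \<noteq> {} \<and> B \<noteq> {} \<and> A \<inter> B = {} \<and> A \<union> B = G)"

abbreviation matrix_group :: "(complex^'n^'n) set \<Rightarrow> (complex^'n^'n) monoid"
  where "matrix_group G \<equiv> GL\<lparr>carrier := G\<rparr>"

primrec lower_central :: "('a, 'b) monoid_scheme \<Rightarrow> nat \<Rightarrow> 'a set"
  where
    "lower_central G 0 = carrier G"
  | "lower_central G (Suc k) = generate G
       {x \<otimes>\<^bsub>G\<^esub> y \<otimes>\<^bsub>G\<^esub> inv\<^bsub>G\<^esub> x \<otimes>\<^bsub>G\<^esub> inv\<^bsub>G\<^esub> y | x y. x \<in> carrier G \<and> y \<in> lower_central G k}"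

definition nilpotent_group :: "('a, 'b) monoid_scheme \<Rightarrow> bool"
  where "nilpotent_group G \<longleftrightarrow> group G \<and> (\<exists>k. lower_central G k = {\<one>\<^bsub>G\<^esub>})"

text \<open>The group \<open>(\<complex>\<^sup>*)\<^sup>k\<close>, with its elements padded by \<open>1\<close> to functions on all of \<open>\<nat>\<close>,
  and its coordinate ring, the Laurent polynomials in \<open>k\<close> variables.\<close>

definition Gm :: "nat \<Rightarrow> (nat \<Rightarrow> complex) monoid"
  where "Gm k = \<lparr>carrier = {z. (\<forall>i<k. z i \<noteq> 0) \<and> (\<forall>i\<ge>k. z i = 1)},
    mult = (\<lambda>z w i. z i * w i), one = (\<lambda>_. 1)\<rparr>"

definition regular_Gm :: "nat \<Rightarrow> ((nat \<Rightarrow> complex) \<Rightarrow> complex) set"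
  where "regular_Gm k = function_algebra
    ({f. \<exists>i<k. f = (\<lambda>z. z i)} \<union> {f. \<exists>i<k. f = (\<lambda>z. inverse (z i))})"

definition torus :: "(complex^'n^'n) set \<Rightarrow> bool"
  where "torus T \<longleftrightarrow> linear_algebraic_group T \<and>
    (\<exists>k. \<exists>\<phi> \<in> iso (matrix_group T) (Gm k).
       regular_map T regular_GL (regular_Gm k) \<phi> \<and>
       regular_map (carrier (Gm k)) (regular_Gm k) regular_GL (inv_into T \<phi>))"

definition unipotent_group :: "(complex^'n^'n) set \<Rightarrow> bool"
  where "unipotent_group U \<longleftrightarrow> linear_algebraic_group U \<and>
    (\<forall>g\<in>U. \<exists>k. (((**) (g - mat 1)) ^^ k) (mat 1) = 0)"

text \<open>\<open>G = T \<times> U\<close> as algebraic groups, for closed subgroups \<open>T\<close> and \<open>U\<close> of \<open>G\<close>: multiplication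
  \<open>T \<times> U \<rightarrow> G\<close>, which is always a regular map, is a group isomorphism whose inverse is regular.\<close>

definition direct_product_group ::
    "(complex^'n^'n) set \<Rightarrow> (complex^'n^'n) set \<Rightarrow> (complex^'n^'n) set \<Rightarrow> bool"
  where "direct_product_group G T U \<longleftrightarrow>
    linear_algebraic_group G \<and> linear_algebraic_group T \<and> linear_algebraic_group U \<and>
    (\<lambda>(t, u). t ** u) \<in> iso (matrix_group T \<times>\<times> matrix_group U) (matrix_group G) \<and>
    regular_map G regular_GL regular_GL (fst \<circ> inv_into (T \<times> U) (\<lambda>(t, u). t ** u)) \<and>
    regular_map G regular_GL regular_GL (snd \<circ> inv_into (T \<times> U) (\<lambda>(t, u). t ** u))"

text \<open>The tangent space at the identity, inside \<open>gl\<^sub>n\<close>; the Lie bracket is \<^const>\<open>commutator\<close>.\<close>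

definition Lie :: "(complex^'n^'n) set \<Rightarrow> (complex^'n^'n) set"
  where "Lie G = {X. \<forall>f\<in>regular_GL. (\<forall>A\<in>G. f A = 0) \<longrightarrow>
    ((\<lambda>z. f (mat 1 + z *\<^sub>M X)) has_field_derivative 0) (at 0)}"

section \<open>Tensors\<close>

text \<open>For \<open>\<gg> \<subseteq> gl\<^sub>n\<close>, the spaces \<open>\<gg> \<otimes> \<gg>\<close> and \<open>\<gg> \<otimes> \<gg> \<otimes> \<gg>\<close> are realised inside
  \<open>gl\<^sub>n \<otimes> gl\<^sub>n\<close> and \<open>gl\<^sub>n \<otimes> gl\<^sub>n \<otimes> gl\<^sub>n\<close>, that is, as spaces of matrices indexed by pairs and
  triples, with the Kronecker product as the tensor product of elements.\<close>

definition kron :: "complex^'n^'n \<Rightarrow> complex^'m^'m \<Rightarrow> complex^('n::finite \<times> 'm::finite)^('n \<times> 'm)" (infixr "\<otimes>\<^sub>K" 72)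
  where "A \<otimes>\<^sub>K B = (\<chi> p q. A $ fst p $ fst q * B $ snd p $ snd q)"

definition tensor_space ::
    "(complex^'n^'n) set \<Rightarrow> (complex^'m^'m) set \<Rightarrow> (complex^('n::finite \<times> 'm::finite)^('n \<times> 'm)) set"
  where "tensor_space V W = cmat.span {x \<otimes>\<^sub>K y | x y. x \<in> V \<and> y \<in> W}"

text \<open>\<open>w \<mapsto> w\<^sub>2\<^sub>1\<close>\<close>

definition tensor_flip :: "complex^('n::finite \<times> 'n)^('n \<times> 'n) \<Rightarrow> complex^('n::finite \<times> 'n)^('n \<times> 'n)"
  where "tensor_flip w = (\<chi> p q. w $ prod.swap p $ prod.swap q)"

definition wedge2 :: "(complex^'n^'n) set \<Rightarrow> (complex^('n::finite \<times> 'n)^('n \<times> 'n)) set"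
  where "wedge2 V = {r \<in> tensor_space V V. tensor_flip r = - r}"

text \<open>\<open>r\<^sub>1\<^sub>2\<close>, \<open>r\<^sub>1\<^sub>3\<close> and \<open>r\<^sub>2\<^sub>3\<close>\<close>

definition leg12 :: "complex^('n::finite \<times> 'n)^('n \<times> 'n) \<Rightarrow> complex^('n::finite \<times> 'n \<times> 'n)^('n \<times> 'n \<times> 'n)"
  where "leg12 r = (\<chi> p q. case (p, q) of ((i, j, k), (i', j', k')) \<Rightarrow>
    r $ (i, j) $ (i', j') * mat 1 $ k $ k')"

definition leg13 :: "complex^('n::finite \<times> 'n)^('n \<times> 'n) \<Rightarrow> complex^('n::finite \<times> 'n \<times> 'n)^('n \<times> 'n \<times> 'n)"
  where "leg13 r = (\<chi> p q. case (p, q) of ((i, j, k), (i', j', k')) \<Rightarrow>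
    r $ (i, k) $ (i', k') * mat 1 $ j $ j')"

definition leg23 :: "complex^('n::finite \<times> 'n)^('n \<times> 'n) \<Rightarrow> complex^('n::finite \<times> 'n \<times> 'n)^('n \<times> 'n \<times> 'n)"
  where "leg23 r = (\<chi> p q. case (p, q) of ((i, j, k), (i', j', k')) \<Rightarrow>
    r $ (j, k) $ (j', k') * mat 1 $ i $ i')"

text \<open>The brackets are computed in the associative algebra \<open>gl\<^sub>n \<otimes> gl\<^sub>n \<otimes> gl\<^sub>n\<close> instead of
  \<open>U(\<gg>) \<otimes> U(\<gg>) \<otimes> U(\<gg>)\<close>. Both give the same element of \<open>\<gg> \<otimes> \<gg> \<otimes> \<gg>\<close>: the inclusion of
  \<open>\<gg>\<close> extends to an algebra map from \<open>U(\<gg>)\<close> to \<open>gl\<^sub>n\<close>, and on products of pure tensors either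
  computation yields the formulas of lemmas \<open>commutator_leg12_leg13\<close>, \<open>commutator_leg12_leg23\<close>
  and \<open>commutator_leg13_leg23\<close> below.\<close>

definition CYB :: "complex^('n::finite \<times> 'n)^('n \<times> 'n) \<Rightarrow> complex^('n::finite \<times> 'n \<times> 'n)^('n \<times> 'n \<times> 'n)"
  where "CYB r = commutator (leg12 r) (leg13 r) + commutator (leg12 r) (leg23 r)
    + commutator (leg13 r) (leg23 r)"

definition CYBE_solution :: "(complex^'n^'n) set \<Rightarrow> complex^('n::finite \<times> 'n)^('n \<times> 'n) \<Rightarrow> bool"
  where "CYBE_solution V r \<longleftrightarrow> r \<in> wedge2 V \<and> CYB r = 0"

lemma kron_mult: "(A \<otimes>\<^sub>K B) ** (C \<otimes>\<^sub>K D) = (A ** C) \<otimes>\<^sub>K (B ** D)"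
proof -
  have "(\<Sum>p\<in>UNIV. (A $ i $ fst p * B $ j $ snd p) * (C $ fst p $ k * D $ snd p $ l))
      = (\<Sum>a\<in>UNIV. A $ i $ a * C $ a $ k) * (\<Sum>b\<in>UNIV. B $ j $ b * D $ b $ l)" for i j k l
    unfolding UNIV_Times_UNIV[symmetric] sum.cartesian_product' sum_product
    by (simp add: mult_ac)
  then show ?thesis
    by (simp add: kron_def matrix_matrix_mult_def vec_eq_iff)
qed

lemma kron_diff_left: "(A - B) \<otimes>\<^sub>K C = A \<otimes>\<^sub>K C - B \<otimes>\<^sub>K C"
  and kron_diff_right: "C \<otimes>\<^sub>K (A - B) = C \<otimes>\<^sub>K A - C \<otimes>\<^sub>K B"
  by (simp_all add: kron_def vec_eq_iff algebra_simps)

lemma tensor_flip_kron: "tensor_flip (x \<otimes>\<^sub>K y) = y \<otimes>\<^sub>K x"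
  by (simp add: tensor_flip_def kron_def vec_eq_iff)

lemma leg12_kron: "leg12 (x \<otimes>\<^sub>K y) = x \<otimes>\<^sub>K y \<otimes>\<^sub>K mat 1"
  and leg13_kron: "leg13 (x \<otimes>\<^sub>K y) = x \<otimes>\<^sub>K mat 1 \<otimes>\<^sub>K y"
  and leg23_kron: "leg23 (x \<otimes>\<^sub>K y) = mat 1 \<otimes>\<^sub>K x \<otimes>\<^sub>K y"
  by (simp_all add: leg12_def leg13_def leg23_def kron_def vec_eq_iff split_beta)

lemma commutator_leg12_leg13:
  "commutator (leg12 (x \<otimes>\<^sub>K y)) (leg13 (x' \<otimes>\<^sub>K y')) = commutator x x' \<otimes>\<^sub>K y \<otimes>\<^sub>K y'"
  by (simp add: commutator_def leg12_kron leg13_kron kron_mult kron_diff_left)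

lemma commutator_leg12_leg23:
  "commutator (leg12 (x \<otimes>\<^sub>K y)) (leg23 (x' \<otimes>\<^sub>K y')) = x \<otimes>\<^sub>K commutator y x' \<otimes>\<^sub>K y'"
  by (simp add: commutator_def leg12_kron leg23_kron kron_mult kron_diff_left kron_diff_right)

lemma commutator_leg13_leg23:
  "commutator (leg13 (x \<otimes>\<^sub>K y)) (leg23 (x' \<otimes>\<^sub>K y')) = x \<otimes>\<^sub>K x' \<otimes>\<^sub>K commutator y y'"
  by (simp add: commutator_def leg13_kron leg23_kron kron_mult kron_diff_right)

end

theory Submission
  imports Defs
begin

text \<open>
  The torus \<open>T\<close> is commutative and commutes with \<open>U\<close>, so \<open>\<tt>\<close> is central in \<open>\<gg> = \<tt> \<oplus> \<uu>\<close>; the decomposition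
  of \<open>\<gg>\<close> comes from differentiating the two regular projections of \<open>G\<close> at the identity. Let \<open>p\<close> and
  \<open>q\<close> be the projections of \<open>\<gg>\<close> to \<open>\<uu>\<close> and \<open>\<tt>\<close>, and put \<open>s = (q \<otimes> q) \<rho>\<close>, \<open>w = (q \<otimes> p) \<rho>\<close>,
  \<open>r = (p \<otimes> p) \<rho>\<close>. Since \<open>p\<close> is a homomorphism of Lie algebras, \<open>CYB r = (p \<otimes> p \<otimes> p) (CYB \<rho>) = 0\<close>.
  The functional \<open>\<phi>\<^sub>i\<close> dual to \<open>t\<^sub>i\<close> and zero on \<open>\<uu>\<close> kills all brackets, so contracting the first leg
  of \<open>CYB \<rho>\<close> with it leaves \<open>[v\<^sub>i \<otimes> 1 + 1 \<otimes> v\<^sub>i, \<rho>] = 0\<close> for \<open>v\<^sub>i = (\<phi>\<^sub>i \<otimes> 1) \<rho>\<close>;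
  applying \<open>p \<otimes> p\<close> gives the condition on \<open>u\<^sub>i = p v\<^sub>i\<close> and \<open>r\<close>.
\<close>

section \<open>Linear maps on tensor products\<close>

interpretation cmat_pair: vector_space_pair
  "cscale :: complex \<Rightarrow> complex^'n^'m \<Rightarrow> complex^'n^'m"
  "cscale :: complex \<Rightarrow> complex^'a^'b \<Rightarrow> complex^'a^'b"
  by unfold_locales

interpretation cmat_functional: vector_space_pair
  "cscale :: complex \<Rightarrow> complex^'n^'m \<Rightarrow> complex^'n^'m" "(*) :: complex \<Rightarrow> complex \<Rightarrow> complex"
  by unfold_locales (simp_all add: algebra_simps)

abbreviation clinear_map :: "(complex^'n^'m \<Rightarrow> complex^'a^'b) \<Rightarrow> bool"
  where "clinear_map \<equiv> Vector_Spaces.linear cscale cscale"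

abbreviation clinear_functional :: "(complex^'n^'m \<Rightarrow> complex) \<Rightarrow> bool"
  where "clinear_functional \<equiv> Vector_Spaces.linear cscale (*)"

lemma clinear_mapI:
  assumes "\<And>x y. f (x + y) = f x + f y" and "\<And>c x. f (c *\<^sub>M x) = c *\<^sub>M f x"
  shows "clinear_map f"
  using assms by (intro Vector_Spaces.linear.intro module_hom.intro module_hom_axioms.intro)
    (simp_all add: cmat.vector_space_axioms cmat.module_axioms)

lemma clinear_functionalI:
  assumes "\<And>x y. f (x + y) = f x + f y" and "\<And>c x. f (c *\<^sub>M x) = c * f x"
  shows "clinear_functional f"
  using assms by (simp add: Vector_Spaces.linear_iff cmat.vector_space_axioms vector_space_def algebra_simps)

lemma clinear_map_add: "clinear_map f \<Longrightarrow> f (x + y) = f x + f y"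
  and clinear_map_scale: "clinear_map f \<Longrightarrow> f (c *\<^sub>M x) = c *\<^sub>M f x"
  and clinear_map_0: "clinear_map f \<Longrightarrow> f 0 = 0"
  and clinear_map_sum: "clinear_map f \<Longrightarrow> f (sum g A) = (\<Sum>a\<in>A. f (g a))"
  by (rule cmat_pair.linear_add cmat_pair.linear_scale
      cmat_pair.linear_0 cmat_pair.linear_sum; assumption)+

lemma clinear_functional_add: "clinear_functional f \<Longrightarrow> f (x + y) = f x + f y"
  and clinear_functional_scale: "clinear_functional f \<Longrightarrow> f (c *\<^sub>M x) = c * f x"
  by (rule cmat_functional.linear_add cmat_functional.linear_scale; assumption)+

lemma cscale_nth [simp]: "(c *\<^sub>M A) $ i $ j = c * A $ i $ j"
  by (simp add: cscale_def)

lemma cscale_minus1: "(-1) *\<^sub>M A = - A"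
  by (simp add: cscale_def vec_eq_iff)

lemma clinear_map_minus: "clinear_map f \<Longrightarrow> f (- x) = - f x"
  by (metis clinear_map_scale cscale_minus1)

lemma clinear_map_image_span:
  assumes "clinear_map f" "\<And>x. x \<in> S \<Longrightarrow> f x \<in> cmat.span S'" "x \<in> cmat.span S"
  shows "f x \<in> cmat.span S'"
  using assms(3)
proof (induction rule: cmat.span_induct_alt)
  case base
  then show ?case by (simp add: clinear_map_0[OF assms(1)] cmat.span_zero)
next
  case (step c x y)
  then show ?case
    by (simp add: clinear_map_add[OF assms(1)] clinear_map_scale[OF assms(1)]
        cmat.span_add cmat.span_scale assms(2))
qed

lemma mult_cscale_left: "(c *\<^sub>M A) ** B = c *\<^sub>M (A ** B)"
  and mult_cscale_right: "A ** (c *\<^sub>M B) = c *\<^sub>M (A ** B)"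
  by (simp_all add: cscale_def matrix_matrix_mult_def vec_eq_iff sum_distrib_left mult_ac)

lemma matrix_mult_add_left: "(A + B) ** C = A ** C + B ** (C :: complex^'n^'m)"
  by (simp add: matrix_matrix_mult_def vec_eq_iff sum.distrib distrib_right)

lemma commutator_linear [simp]:
  "commutator (A + B) C = commutator A C + commutator B C"
  "commutator C (A + B) = commutator C A + commutator C B"
  "commutator (c *\<^sub>M A) C = c *\<^sub>M commutator A C"
  "commutator C (c *\<^sub>M A) = c *\<^sub>M commutator C A"
  by (simp_all add: commutator_def matrix_add_ldistrib matrix_mult_add_left
      mult_cscale_left mult_cscale_right cmat.scale_right_diff_distrib)

lemma kron_linear [simp]:
  "(A + B) \<otimes>\<^sub>K C = A \<otimes>\<^sub>K C + B \<otimes>\<^sub>K C"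
  "C \<otimes>\<^sub>K (A + B) = C \<otimes>\<^sub>K A + C \<otimes>\<^sub>K B"
  "(c *\<^sub>M A) \<otimes>\<^sub>K C = c *\<^sub>M (A \<otimes>\<^sub>K C)"
  "C \<otimes>\<^sub>K (c *\<^sub>M A) = c *\<^sub>M (C \<otimes>\<^sub>K A)"
  by (simp_all add: kron_def cscale_def vec_eq_iff algebra_simps)

lemma leg_linear [simp]:
  "leg12 (x + y) = leg12 x + leg12 y" "leg12 (c *\<^sub>M x) = c *\<^sub>M leg12 x"
  "leg13 (x + y) = leg13 x + leg13 y" "leg13 (c *\<^sub>M x) = c *\<^sub>M leg13 x"
  "leg23 (x + y) = leg23 x + leg23 y" "leg23 (c *\<^sub>M x) = c *\<^sub>M leg23 x"
  by (simp_all add: leg12_def leg13_def leg23_def cscale_def vec_eq_iff algebra_simps)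

lemma tensor_flip_linear [simp]:
  "tensor_flip (x + y) = tensor_flip x + tensor_flip y"
  "tensor_flip (c *\<^sub>M x) = c *\<^sub>M tensor_flip x"
  by (simp_all add: tensor_flip_def cscale_def vec_eq_iff)

lemmas cscale_linear = cmat.scale_right_distrib cmat.scale_left_distrib cmat.scale_left_commute

section \<open>Matrix units and linear maps out of tensor products\<close>

definition matrix_unit :: "'m \<Rightarrow> 'n \<Rightarrow> complex^'n^'m"
  where "matrix_unit i j = (\<chi> a b. if a = i \<and> b = j then 1 else 0)"

lemma matrix_unit_expansion: "A = (\<Sum>i\<in>UNIV. \<Sum>j\<in>UNIV. A $ i $ j *\<^sub>M matrix_unit i j)"
proof -
  have "(\<Sum>i\<in>UNIV. \<Sum>j\<in>UNIV. A $ i $ j * (if a = i \<and> b = j then 1 else 0)) = A $ a $ b" for a b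
  proof -
    have "(\<Sum>i\<in>UNIV. \<Sum>j\<in>UNIV. A $ i $ j * (if a = i \<and> b = j then 1 else 0))
        = (\<Sum>i\<in>UNIV. if a = i then A $ i $ b else 0)"
      by (intro sum.cong refl) (simp add: if_distrib cong: if_cong)
    then show ?thesis by simp
  qed
  then show ?thesis
    by (simp add: vec_eq_iff matrix_unit_def cscale_def)
qed

text \<open>The finitely many matrix units span, which bounds the size of an independent set. Sums
  over bases below range over sets, and a sum over an infinite set would be 0 by default.\<close>

lemma finite_if_cindependent:
  fixes B :: "(complex^'n^'m) set"
  assumes "cmat.independent B"
  shows "finite B"
proof -
  let ?E = "(\<lambda>(i, j). matrix_unit i j) ` UNIV :: (complex^'n^'m) set"
  have "A \<in> cmat.span ?E" for A
    by (subst matrix_unit_expansion)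
      (intro cmat.span_sum cmat.span_scale cmat.span_base, force)
  then show ?thesis
    using cmat.independent_span_bound[of ?E B] assms by (simp add: subset_iff)
qed

text \<open>The linear map that the universal property of the tensor product attaches to
  \<open>\<beta>\<close>. The entry of \<open>M\<close> at \<open>(i, k)\<close> and
  \<open>(j, l)\<close> is its coefficient at
  \<open>matrix_unit i j \<otimes>\<^sub>K matrix_unit k l\<close>. Linearity in \<open>M\<close>
  thus holds for every \<open>\<beta>\<close>; bilinearity of \<open>\<beta>\<close> enters in
  \<open>bilinear_lift_kron\<close>.\<close>

definition bilinear_lift ::
    "(complex^'n^'n \<Rightarrow> complex^'m^'m \<Rightarrow> complex^'a^'b) \<Rightarrow> complex^('n::finite \<times> 'm::finite)^('n \<times> 'm) \<Rightarrow> complex^'a^'b"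
  where "bilinear_lift \<beta> M = (\<Sum>i\<in>UNIV. \<Sum>j\<in>UNIV. \<Sum>k\<in>UNIV. \<Sum>l\<in>UNIV.
    M $ (i, k) $ (j, l) *\<^sub>M \<beta> (matrix_unit i j) (matrix_unit k l))"

lemma bilinear_lift_linear: "clinear_map (bilinear_lift \<beta>)"
proof (rule clinear_mapI)
  show "bilinear_lift \<beta> (x + y) = bilinear_lift \<beta> x + bilinear_lift \<beta> y" for x y
    by (simp add: bilinear_lift_def cmat.scale_left_distrib sum.distrib)
  show "bilinear_lift \<beta> (c *\<^sub>M x) = c *\<^sub>M bilinear_lift \<beta> x" for c x
    by (simp add: bilinear_lift_def cmat.scale_sum_right)
qed

lemma bilinear_lift_kron:
  assumes "\<And>y. clinear_map (\<lambda>x. \<beta> x y)" and "\<And>x. clinear_map (\<beta> x)"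
  shows "bilinear_lift \<beta> (x \<otimes>\<^sub>K y) = \<beta> x y"
proof -
  have "\<beta> x y = \<beta> (\<Sum>i\<in>UNIV. \<Sum>j\<in>UNIV. x $ i $ j *\<^sub>M matrix_unit i j) y"
    using matrix_unit_expansion[of x] by simp
  also have "\<dots> = (\<Sum>i\<in>UNIV. \<Sum>j\<in>UNIV. x $ i $ j *\<^sub>M \<beta> (matrix_unit i j) y)"
    by (simp add: clinear_map_sum[OF assms(1)] clinear_map_scale[OF assms(1)])
  also have "\<dots> = (\<Sum>i\<in>UNIV. \<Sum>j\<in>UNIV. x $ i $ j *\<^sub>M
      (\<Sum>k\<in>UNIV. \<Sum>l\<in>UNIV. y $ k $ l *\<^sub>M \<beta> (matrix_unit i j) (matrix_unit k l)))"
    by (subst matrix_unit_expansion[of y]) 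
      (simp add: clinear_map_sum[OF assms(2)] clinear_map_scale[OF assms(2)])
  also have "\<dots> = bilinear_lift \<beta> (x \<otimes>\<^sub>K y)"
    by (simp add: bilinear_lift_def kron_def cmat.scale_sum_right)
  finally show ?thesis by simp
qed

definition tensor_map :: "(complex^'n^'n \<Rightarrow> complex^'a^'a) \<Rightarrow> (complex^'m^'m \<Rightarrow> complex^'b^'b)
    \<Rightarrow> complex^('n::finite \<times> 'm::finite)^('n \<times> 'm) \<Rightarrow> complex^('a::finite \<times> 'b::finite)^('a \<times> 'b)"
  where "tensor_map f g = bilinear_lift (\<lambda>x y. f x \<otimes>\<^sub>K g y)"

lemma tensor_map_linear: "clinear_map (tensor_map f g)"
  by (simp add: tensor_map_def bilinear_lift_linear)

lemmas tensor_map_simps [simp] =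
  clinear_map_add[OF tensor_map_linear] clinear_map_scale[OF tensor_map_linear]
  clinear_map_minus[OF tensor_map_linear]

lemma tensor_map_kron:
  assumes "clinear_map f" "clinear_map g"
  shows "tensor_map f g (x \<otimes>\<^sub>K y) = f x \<otimes>\<^sub>K g y"
  unfolding tensor_map_def
  by (rule bilinear_lift_kron; rule clinear_mapI;
      simp add: assms clinear_map_add clinear_map_scale)

text \<open>This is \<phi> \<otimes> 1, with the resulting scalar absorbed into the second factor.
  As \<open>\<otimes>\<^sub>K\<close> nests to the right, on threefold tensors it removes the first
  leg and leaves a twofold tensor.\<close>

definition contract_left :: "(complex^'n^'n \<Rightarrow> complex) \<Rightarrow>
    complex^('n::finite \<times> 'm::finite)^('n \<times> 'm) \<Rightarrow> complex^'m^'m"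
  where "contract_left \<phi> = bilinear_lift (\<lambda>x y. \<phi> x *\<^sub>M y)"

lemma contract_left_linear: "clinear_map (contract_left \<phi>)"
  by (simp add: contract_left_def bilinear_lift_linear)

lemmas contract_left_simps [simp] =
  clinear_map_add[OF contract_left_linear] clinear_map_scale[OF contract_left_linear]

lemma contract_left_kron:
  assumes "clinear_functional \<phi>"
  shows "contract_left \<phi> (x \<otimes>\<^sub>K y) = \<phi> x *\<^sub>M y"
  unfolding contract_left_def
  by (rule bilinear_lift_kron; rule clinear_mapI;
      simp add: assms clinear_functional_add clinear_functional_scale cscale_linear)

lemma tensor_space_eqI:
  assumes "clinear_map f" "clinear_map g" "\<rho> \<in> tensor_space V W"
    and "\<And>x y. x \<in> V \<Longrightarrow> y \<in> W \<Longrightarrow> f (x \<otimes>\<^sub>K y) = g (x \<otimes>\<^sub>K y)"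
  shows "f \<rho> = g \<rho>"
  by (rule cmat_pair.linear_eq_on[OF assms(1,2) assms(3)[unfolded tensor_space_def]])
    (use assms(4) in blast)

text \<open>\<open>tensor_space_eqI\<close> applied to one argument after the other. It serves
  identities that are quadratic in a tensor: once polarised, they need checking on pairs of pure
  tensors only.\<close>

lemma tensor_space_bilinear_eqI:
  assumes "\<And>y. clinear_map (\<lambda>x. f x y)" "\<And>x. clinear_map (f x)"
    and "\<And>y. clinear_map (\<lambda>x. g x y)" "\<And>x. clinear_map (g x)"
    and "\<rho> \<in> tensor_space V W" "\<sigma> \<in> tensor_space V' W'"
    and "\<And>x y x' y'. x \<in> V \<Longrightarrow> y \<in> W \<Longrightarrow> x' \<in> V' \<Longrightarrow> y' \<in> W' \<Longrightarrow>
      f (x \<otimes>\<^sub>K y) (x' \<otimes>\<^sub>K y') = g (x \<otimes>\<^sub>K y) (x' \<otimes>\<^sub>K y')"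
  shows "f \<rho> \<sigma> = g \<rho> \<sigma>"
proof (rule tensor_space_eqI[OF assms(1,3,5)])
  fix x y assume "x \<in> V" "y \<in> W"
  then show "f (x \<otimes>\<^sub>K y) \<sigma> = g (x \<otimes>\<^sub>K y) \<sigma>"
    by (intro tensor_space_eqI[OF assms(2,4,6)] assms(7))
qed

lemma tensor_map_in_tensor_space:
  assumes "clinear_map f" "clinear_map g" "\<rho> \<in> tensor_space V W"
    and "\<And>x. x \<in> V \<Longrightarrow> f x \<in> V'" "\<And>y. y \<in> W \<Longrightarrow> g y \<in> W'"
  shows "tensor_map f g \<rho> \<in> tensor_space V' W'"
  unfolding tensor_space_def
  by (rule clinear_map_image_span[OF tensor_map_linear _ assms(3)[unfolded tensor_space_def]])
    (use assms in \<open>fastforce simp: tensor_map_kron intro!: cmat.span_base\<close>)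

lemma tensor_flip_tensor_map:
  assumes "clinear_map f" "clinear_map g" "\<rho> \<in> tensor_space V V"
  shows "tensor_flip (tensor_map f g \<rho>) = tensor_map g f (tensor_flip \<rho>)"
  by (rule tensor_space_eqI[OF _ _ assms(3)]; (rule clinear_mapI)?;
      simp add: tensor_map_kron assms tensor_flip_kron)

section \<open>Solutions over a Lie algebra with a central summand\<close>

text \<open>The polarisation of the quadratic map \<^const>\<open>CYB\<close>.\<close>

definition CYB_bilinear :: "complex^('n::finite \<times> 'n)^('n \<times> 'n) \<Rightarrow> complex^('n \<times> 'n)^('n \<times> 'n)
    \<Rightarrow> complex^('n \<times> 'n \<times> 'n)^('n \<times> 'n \<times> 'n)"
  where "CYB_bilinear r r' = commutator (leg12 r) (leg13 r') + commutator (leg12 r) (leg23 r')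
    + commutator (leg13 r) (leg23 r')"

lemma CYB_bilinear_linear:
  "clinear_map (CYB_bilinear r)" "clinear_map (\<lambda>r. CYB_bilinear r r')"
  by (rule clinear_mapI; simp add: CYB_bilinear_def cscale_linear)+

lemmas CYB_bilinear_simps [simp] =
  clinear_map_add[OF CYB_bilinear_linear(1)] clinear_map_scale[OF CYB_bilinear_linear(1)]
  clinear_map_add[OF CYB_bilinear_linear(2)] clinear_map_scale[OF CYB_bilinear_linear(2)]

lemma CYB_bilinear_kron: "CYB_bilinear (x \<otimes>\<^sub>K y) (x' \<otimes>\<^sub>K y') =
    commutator x x' \<otimes>\<^sub>K y \<otimes>\<^sub>K y' + x \<otimes>\<^sub>K commutator y x' \<otimes>\<^sub>K y' + x \<otimes>\<^sub>K x' \<otimes>\<^sub>K commutator y y'"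
  by (simp add: CYB_bilinear_def commutator_leg12_leg13 commutator_leg12_leg23 commutator_leg13_leg23)

text \<open>After polarisation both sides are bilinear, so pure tensors suffice. There each of the
  three terms in \<open>CYB_bilinear_kron\<close> contains a single commutator of elements of
  \<open>V\<close>, through which \<open>f\<close> passes.\<close>

lemma CYB_tensor_map:
  assumes "clinear_map f" "\<rho> \<in> tensor_space V V"
    and "\<And>x y. x \<in> V \<Longrightarrow> y \<in> V \<Longrightarrow> f (commutator x y) = commutator (f x) (f y)"
  shows "CYB (tensor_map f f \<rho>) = tensor_map f (tensor_map f f) (CYB \<rho>)"
proof -
  have "CYB_bilinear (tensor_map f f \<rho>) (tensor_map f f \<rho>)
      = tensor_map f (tensor_map f f) (CYB_bilinear \<rho> \<rho>)"
    by (rule tensor_space_bilinear_eqI[OF _ _ _ _ assms(2,2),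
          where f = "\<lambda>\<rho> \<sigma>. CYB_bilinear (tensor_map f f \<rho>) (tensor_map f f \<sigma>)"
            and g = "\<lambda>\<rho> \<sigma>. tensor_map f (tensor_map f f) (CYB_bilinear \<rho> \<sigma>)"];
        (rule clinear_mapI)?;
        simp add: tensor_map_kron tensor_map_linear assms CYB_bilinear_kron)
  then show ?thesis
    by (simp add: CYB_def CYB_bilinear_def)
qed

section \<open>The diagonal adjoint action on twofold tensors, and contraction of
  \<open>CYB\<close>\<close>

definition ad2 :: "complex^'n^'n \<Rightarrow> complex^('n::finite \<times> 'n)^('n \<times> 'n) \<Rightarrow> complex^('n \<times> 'n)^('n \<times> 'n)"
  where "ad2 a r = commutator (a \<otimes>\<^sub>K mat 1 + mat 1 \<otimes>\<^sub>K a) r"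

lemma ad2_linear [simp]:
  "ad2 (a + b) r = ad2 a r + ad2 b r" "ad2 (c *\<^sub>M a) r = c *\<^sub>M ad2 a r"
  "ad2 a (r + r') = ad2 a r + ad2 a r'" "ad2 a (c *\<^sub>M r) = c *\<^sub>M ad2 a r"
  by (simp_all add: ad2_def cscale_linear)

lemma ad2_kron: "ad2 a (x \<otimes>\<^sub>K y) = commutator a x \<otimes>\<^sub>K y + x \<otimes>\<^sub>K commutator a y"
  by (simp add: ad2_def) (simp add: commutator_def kron_mult kron_diff_left kron_diff_right)

text \<open>On pure tensors \<open>\<phi>\<close> kills the term with the commutator in the first
  leg. The other two terms combine, by the Leibniz rule \<open>ad2_kron\<close>, to the action of
  \<open>\<phi> x *\<^sub>M y\<close> on the second tensor.\<close>

lemma contract_left_CYB: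
  assumes "clinear_functional \<phi>" "\<rho> \<in> tensor_space V V"
    and "\<And>x y. x \<in> V \<Longrightarrow> y \<in> V \<Longrightarrow> \<phi> (commutator x y) = 0"
  shows "contract_left \<phi> (CYB \<rho>) = ad2 (contract_left \<phi> \<rho>) \<rho>"
proof -
  have "contract_left \<phi> (CYB_bilinear \<rho> \<rho>) = ad2 (contract_left \<phi> \<rho>) \<rho>"
    by (rule tensor_space_bilinear_eqI[OF _ _ _ _ assms(2,2),
          where f = "\<lambda>\<rho> \<sigma>. contract_left \<phi> (CYB_bilinear \<rho> \<sigma>)"
            and g = "\<lambda>\<rho> \<sigma>. ad2 (contract_left \<phi> \<rho>) \<sigma>"];
        (rule clinear_mapI)?;
        simp add: contract_left_kron assms CYB_bilinear_kron ad2_kron cscale_linear)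
  then show ?thesis
    by (simp add: CYB_def CYB_bilinear_def)
qed


text \<open>Join \<open>B\<close> to a basis \<open>C\<close> of \<open>u\<close> and prescribe
  linear maps on the union: \<open>p\<close> is 0 on \<open>B\<close> and the identity on
  \<open>C\<close>, while \<open>\<phi> b\<close> is the coordinate at \<open>b\<close>.\<close>

lemma complementary_projection:
  fixes B :: "(complex^'n^'m) set"
  assumes indep: "cmat.independent B" and u: "cmat.subspace u" and int: "cmat.span B \<inter> u \<subseteq> {0}"
  obtains p \<phi> where "clinear_map p" "\<And>x. x \<in> u \<Longrightarrow> p x = x" "\<And>x. x \<in> cmat.span B \<Longrightarrow> p x = 0"
    and "\<And>b. clinear_functional (\<phi> b)" "\<And>b x. x \<in> u \<Longrightarrow> \<phi> b x = 0"
    and "\<And>x. x \<in> cmat.span B \<Longrightarrow> (\<Sum>b\<in>B. \<phi> b x *\<^sub>M b) = x"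
proof -
  obtain C where C: "C \<subseteq> u" "cmat.independent C" "u \<subseteq> cmat.span C"
    using cmat.maximal_independent_subset[of u] by blast
  have spanC: "cmat.span C \<subseteq> u"
    using C(1) u by (rule cmat.span_minimal)
  have fin: "finite B" "finite C"
    using indep C(2) finite_if_cindependent by blast+
  have "x \<noteq> 0" if "x \<in> B" for x
    using that indep cmat.dependent_zero by blast
  then have disj: "B \<inter> C = {}"
    using int C(1) cmat.span_superset by blast
  \<comment> \<open>In a vanishing combination the part over \<open>B\<close> is minus the part over
    \<open>C\<close>, so it lies in both \<open>cmat.span B\<close> and \<open>u\<close> and is
    0.\<close>
  have indepBC: "cmat.independent (B \<union> C)"
  proof (rule cmat.independent_if_scalars_zero)
    fix c x assume sum: "(\<Sum>x\<in>B \<union> C. c x *\<^sub>M x) = 0" and x: "x \<in> B \<union> C"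
    have *: "(\<Sum>x\<in>B. c x *\<^sub>M x) + (\<Sum>x\<in>C. c x *\<^sub>M x) = 0"
      using sum fin disj by (simp add: sum.union_disjoint)
    have inB: "(\<Sum>x\<in>B. c x *\<^sub>M x) \<in> cmat.span B" and inC: "(\<Sum>x\<in>C. c x *\<^sub>M x) \<in> cmat.span C"
      by (intro cmat.span_sum cmat.span_scale cmat.span_base; assumption)+
    have "(\<Sum>x\<in>B. c x *\<^sub>M x) = - (\<Sum>x\<in>C. c x *\<^sub>M x)"
      using * by (simp add: eq_neg_iff_add_eq_0)
    then have "(\<Sum>x\<in>B. c x *\<^sub>M x) \<in> u"
      using inC spanC u by (simp add: cmat.subspace_neg subset_iff)
    then have "(\<Sum>x\<in>B. c x *\<^sub>M x) = 0"
      using inB int by blast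
    moreover from this * have "(\<Sum>x\<in>C. c x *\<^sub>M x) = 0"
      by simp
    ultimately show "c x = 0"
      using x fin cmat.independentD[OF indep fin(1)] cmat.independentD[OF C(2) fin(2)] by blast
  qed (use fin in simp)
  \<comment> \<open>The extension is defined on all matrices; outside the span of
    \<open>B \<union> C\<close> its values are left unspecified.\<close>
  obtain p where p: "clinear_map p" "\<forall>x\<in>B \<union> C. p x = (if x \<in> B then 0 else x)"
    using cmat_pair.linear_independent_extend[OF indepBC, of "\<lambda>x. if x \<in> B then 0 else x"] by blast
  \<comment> \<open>The guard \<open>b \<in> B\<close> keeps \<open>\<phi> b\<close> zero on
    \<open>u\<close> even when the index \<open>b\<close> happens to lie in
    \<open>C\<close>.\<close>
  have "\<exists>\<phi>. clinear_functional \<phi> \<and> (\<forall>x\<in>B \<union> C. \<phi> x = (if x = b \<and> b \<in> B then 1 else 0))" for b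
    using cmat_functional.linear_independent_extend[OF indepBC,
        of "\<lambda>x. if x = b \<and> b \<in> B then 1 else 0"] .
  then obtain \<phi> where \<phi>: "clinear_functional (\<phi> b)"
    "\<forall>x\<in>B \<union> C. \<phi> b x = (if x = b \<and> b \<in> B then 1 else 0)" for b
    by metis
  have zero: "clinear_map (\<lambda>x. 0)" and id: "clinear_map (\<lambda>x. x)"
    by (rule clinear_mapI; simp)+
  show thesis
  proof
    show "clinear_map p" by (fact p(1))
    show "p x = x" if "x \<in> u" for x
      by (rule cmat_pair.linear_eq_on[OF p(1) id, of x C]) (use that C(3) disj p(2) in auto)
    show "p x = 0" if "x \<in> cmat.span B" for x
      by (rule cmat_pair.linear_eq_on[OF p(1) zero that]) (use p(2) in auto)
    show "clinear_functional (\<phi> b)" for b by (fact \<phi>(1))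
    show "\<phi> b x = 0" if "x \<in> u" for b x
      by (rule cmat_functional.linear_eq_on[OF \<phi>(1) cmat_functional.linear_zero, of x C])
        (use that C(3) disj \<phi>(2) in auto)
    have "clinear_map (\<lambda>x. \<Sum>b\<in>B. \<phi> b x *\<^sub>M b)"
      by (rule clinear_mapI)
        (simp_all add: clinear_functional_add[OF \<phi>(1)] clinear_functional_scale[OF \<phi>(1)]
          cmat.scale_left_distrib sum.distrib cmat.scale_sum_right)
    then show "(\<Sum>b\<in>B. \<phi> b x *\<^sub>M b) = x" if "x \<in> cmat.span B" for x
    proof (rule cmat_pair.linear_eq_on[OF _ id that])
      fix x assume "x \<in> B"
      then have "(\<Sum>b\<in>B. \<phi> b x *\<^sub>M b) = (\<Sum>b\<in>B. if b = x then x else 0)"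
        using \<phi>(2) by (intro sum.cong) auto
      then show "(\<Sum>b\<in>B. \<phi> b x *\<^sub>M b) = x"
        using \<open>x \<in> B\<close> fin by simp
    qed
  qed
qed

text \<open>The algebraic half of the argument, free of groups: \<open>cmat.span B\<close> plays
  \<tt>, \<open>u\<close> plays \<uu> and \<open>V\<close> plays \<gg>. The set \<open>V\<close>
  enters through the splitting of its elements and through the tensors that it generates.\<close>

lemma CYBE_decomposition:
  fixes B u V :: "(complex^'n::finite^'n) set" and \<rho> :: "complex^('n \<times> 'n)^('n \<times> 'n)"
  assumes indep: "cmat.independent B" and u: "cmat.subspace u"
    and int: "cmat.span B \<inter> u \<subseteq> {0}"
    and V: "V \<subseteq> {x + y | x y. x \<in> cmat.span B \<and> y \<in> u}"
    and comm_t: "\<And>x y. x \<in> cmat.span B \<Longrightarrow> y \<in> cmat.span B \<Longrightarrow> commutator x y = 0"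
    and comm_tu: "\<And>x y. x \<in> cmat.span B \<Longrightarrow> y \<in> u \<Longrightarrow> commutator x y = 0"
    and comm_u: "\<And>x y. x \<in> u \<Longrightarrow> y \<in> u \<Longrightarrow> commutator x y \<in> u"
    and \<rho>: "CYBE_solution V \<rho>"
  shows "\<exists>s r v w.
    s \<in> wedge2 (cmat.span B) \<and>
    CYBE_solution u r \<and>
    (\<forall>b\<in>B. v b \<in> u) \<and>
    w = (\<Sum>b\<in>B. b \<otimes>\<^sub>K v b) \<and>
    (\<forall>b\<in>B. commutator (v b \<otimes>\<^sub>K mat 1 + mat 1 \<otimes>\<^sub>K v b) r = 0) \<and>
    \<rho> = s + (w - tensor_flip w) + r"
proof -
  obtain p \<phi> where p: "clinear_map p" "\<And>x. x \<in> u \<Longrightarrow> p x = x" "\<And>x. x \<in> cmat.span B \<Longrightarrow> p x = 0"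
    and \<phi>: "\<And>b. clinear_functional (\<phi> b)" "\<And>b x. x \<in> u \<Longrightarrow> \<phi> b x = 0"
      "\<And>x. x \<in> cmat.span B \<Longrightarrow> (\<Sum>b\<in>B. \<phi> b x *\<^sub>M b) = x"
    using complementary_projection[OF indep u int] by blast
  \<comment> \<open>On \<open>V\<close> this agrees with \<open>x - p x\<close>. The form through
    the dual functionals keeps the values in \<open>cmat.span B\<close> for every matrix and makes
    the expansion of \<open>w\<close> along \<open>B\<close> immediate.\<close>
  define q where "q x = (\<Sum>b\<in>B. \<phi> b x *\<^sub>M b)" for x
  have q: "clinear_map q" unfolding q_def
    by (rule clinear_mapI)
      (simp_all add: clinear_functional_add[OF \<phi>(1)] clinear_functional_scale[OF \<phi>(1)]
        cmat.scale_left_distrib sum.distrib cmat.scale_sum_right)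
  have q_t: "q x \<in> cmat.span B" for x
    unfolding q_def by (intro cmat.span_sum cmat.span_scale cmat.span_base)
  have comm_ut: "commutator x y = 0" if "x \<in> u" "y \<in> cmat.span B" for x y
    using comm_tu[OF that(2,1)] by (simp add: commutator_def)
  have split: "p x \<in> u \<and> q x + p x = x" if "x \<in> V" for x
  proof -
    obtain a c where x: "x = a + c" "a \<in> cmat.span B" "c \<in> u" using V \<open>x \<in> V\<close> by blast
    have "q c = 0" "q a = a" using x \<phi> by (simp_all add: q_def)
    then show ?thesis
      using x p by (simp add: clinear_map_add[OF p(1)] clinear_map_add[OF q])
  qed
  \<comment> \<open>Elements of \<open>cmat.span B\<close> commute with one another and with
    \<open>u\<close>, so only the \<open>u\<close>-components contribute.\<close>
  have comm_V: "commutator x y = commutator (p x) (p y)" if "x \<in> V" "y \<in> V" for x y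
  proof -
    have "commutator x y = commutator (q x + p x) (q y + p y)" using split that by simp
    also have "\<dots> = commutator (p x) (p y)"
      using split[THEN conjunct1] that q_t by (simp add: comm_t comm_tu comm_ut)
    finally show ?thesis .
  qed
  have \<rho>V: "\<rho> \<in> tensor_space V V" and skew: "tensor_flip \<rho> = - \<rho>" and CYB: "CYB \<rho> = 0"
    using \<rho> by (auto simp: CYBE_solution_def wedge2_def)
  define s where "s = tensor_map q q \<rho>"
  define r where "r = tensor_map p p \<rho>"
  define w where "w = tensor_map q p \<rho>"
  define v where "v b = p (contract_left (\<phi> b) \<rho>)" for b
  have s: "s \<in> wedge2 (cmat.span B)" unfolding wedge2_def s_def
    using tensor_map_in_tensor_space[OF q q \<rho>V q_t q_t]
    by (simp add: tensor_flip_tensor_map[OF q q \<rho>V] skew)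
  have r: "r \<in> wedge2 u" unfolding wedge2_def r_def
    using tensor_map_in_tensor_space[OF p(1) p(1) \<rho>V, of u u] split
    by (simp add: tensor_flip_tensor_map[OF p(1) p(1) \<rho>V] skew)
  \<comment> \<open>By \<open>comm_V\<close> the commutator already lies in \<open>u\<close>, where
    \<open>p\<close> is the identity.\<close>
  have pcomm: "p (commutator x y) = commutator (p x) (p y)" if "x \<in> V" "y \<in> V" for x y
    using that split by (simp add: comm_V comm_u p(2))
  have "CYB r = 0"
    unfolding r_def using CYB_tensor_map[OF p(1) \<rho>V pcomm] CYB
    by (simp add: clinear_map_0[OF tensor_map_linear])
  \<comment> \<open>Only the span of \<open>V\<close> is reached, since \<open>V\<close> is an
    arbitrary subset of the sum.\<close>
  moreover have contract: "contract_left (\<phi> b) \<rho> \<in> cmat.span V" for b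
    by (rule clinear_map_image_span[OF contract_left_linear _ \<rho>V[unfolded tensor_space_def]])
      (clarsimp simp: contract_left_kron \<phi>(1), intro cmat.span_scale cmat.span_base)
  moreover have "v b \<in> u" for b
  proof -
    have "v b \<in> cmat.span u" unfolding v_def
      by (rule clinear_map_image_span[OF p(1) _ contract]) (use split in \<open>auto intro: cmat.span_base\<close>)
    then show ?thesis using u by (simp add: cmat.span_eq_iff[THEN iffD2])
  qed
  \<comment> \<open>Both sides are linear in \<open>\<rho>\<close>. On
    \<open>x \<otimes>\<^sub>K y\<close> the claim is \<open>q x \<otimes>\<^sub>K p y\<close> with
    \<open>q x\<close> expanded along \<open>B\<close>.\<close>
  moreover have "w = (\<Sum>b\<in>B. b \<otimes>\<^sub>K v b)"
  proof -
    have "clinear_map (\<lambda>\<rho>. \<Sum>b\<in>B. b \<otimes>\<^sub>K p (contract_left (\<phi> b) \<rho>))"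
      by (rule clinear_mapI)
        (simp_all add: clinear_map_add[OF p(1)] clinear_map_scale[OF p(1)] sum.distrib cmat.scale_sum_right)
    moreover have "tensor_map q p (x \<otimes>\<^sub>K y) = (\<Sum>b\<in>B. b \<otimes>\<^sub>K p (contract_left (\<phi> b) (x \<otimes>\<^sub>K y)))" for x y
    proof -
      have "clinear_map (\<lambda>a. a \<otimes>\<^sub>K p y)" by (rule clinear_mapI) simp_all
      note sum = clinear_map_sum[OF this]
      show ?thesis
        by (simp add: sum tensor_map_kron p q contract_left_kron \<phi>(1) q_def clinear_map_scale[OF p(1)])
    qed
    ultimately show ?thesis
      unfolding w_def v_def by (intro tensor_space_eqI[OF tensor_map_linear _ \<rho>V])
  qed
  moreover have "commutator (v b \<otimes>\<^sub>K mat 1 + mat 1 \<otimes>\<^sub>K v b) r = 0" for b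
  proof -
    \<comment> \<open>Commutators of elements of \<open>V\<close> lie in \<open>u\<close>, where
      \<open>\<phi> b\<close> vanishes, so \<open>contract_left_CYB\<close> applies.\<close>
    have "\<phi> b (commutator x y) = 0" if "x \<in> V" "y \<in> V" for x y
      using that split by (simp add: comm_V \<phi>(2) comm_u)
    then have "ad2 (contract_left (\<phi> b) \<rho>) \<rho> = 0"
      using contract_left_CYB[OF \<phi>(1) \<rho>V, of b] CYB by (simp add: clinear_map_0[OF contract_left_linear])
    \<comment> \<open>Projecting both legs intertwines the two actions because \<open>p\<close>
      respects commutators. \<open>pcomm\<close> is first extended to \<open>cmat.span V\<close> in
      its first argument, where the contraction of \<open>\<rho>\<close> lies.\<close>
    moreover have "tensor_map p p (ad2 a \<rho>) = ad2 (p a) r" if "a \<in> cmat.span V" for a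
    proof -
      have pcomm': "p (commutator a x) = commutator (p a) (p x)" if "x \<in> V" for x
        by (rule cmat_pair.linear_eq_on[OF _ _ \<open>a \<in> cmat.span V\<close>]; (rule clinear_mapI)?)
          (simp_all add: clinear_map_add[OF p(1)] clinear_map_scale[OF p(1)] pcomm that)
      show ?thesis unfolding r_def
        by (rule tensor_space_eqI[OF _ _ \<rho>V]; (rule clinear_mapI)?;
            simp add: tensor_map_kron p(1) ad2_kron pcomm')
    qed
    ultimately show ?thesis
      using contract by (metis ad2_def clinear_map_0[OF tensor_map_linear] v_def)
  qed
  \<comment> \<open>Expand (q + p) \<otimes> (q + p). By skew-symmetry of \<open>\<rho>\<close> the
    flip sends \<open>w\<close> to minus the other mixed term.\<close>
  moreover have "\<rho> = s + (w - tensor_flip w) + r"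
  proof -
    have "\<rho> = tensor_map q q \<rho> + (tensor_map q p \<rho> + tensor_map p q \<rho>) + tensor_map p p \<rho>"
    proof (rule tensor_space_eqI[OF _ _ \<rho>V, where f = "\<lambda>\<rho>. \<rho>"])
      fix x y assume "x \<in> V" "y \<in> V"
      then have "x \<otimes>\<^sub>K y = (q x + p x) \<otimes>\<^sub>K (q y + p y)" using split by simp
      then show "x \<otimes>\<^sub>K y = tensor_map q q (x \<otimes>\<^sub>K y)
          + (tensor_map q p (x \<otimes>\<^sub>K y) + tensor_map p q (x \<otimes>\<^sub>K y)) + tensor_map p p (x \<otimes>\<^sub>K y)"
        unfolding tensor_map_kron[OF q q] tensor_map_kron[OF q p(1)]
          tensor_map_kron[OF p(1) q] tensor_map_kron[OF p(1) p(1)]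
        by (simp only: kron_linear ac_simps)
    qed (rule clinear_mapI; simp add: cscale_linear)+
    moreover have "tensor_flip w = - tensor_map p q \<rho>"
      unfolding w_def by (simp add: tensor_flip_tensor_map[OF q p(1) \<rho>V] skew)
    ultimately show ?thesis by (simp add: s_def r_def w_def)
  qed
  ultimately show ?thesis
    using s r by (intro exI[of _ s] exI[of _ r] exI[of _ v] exI[of _ w]) (simp add: CYBE_solution_def)
qed

section \<open>Regular functions and their differentials at the identity\<close>

lemma function_algebra_mono:
  assumes "X \<subseteq> Y" "f \<in> function_algebra X"
  shows "f \<in> function_algebra Y"
  using assms(2,1) by induction (auto intro: function_algebra.intros)

lemma function_algebra_sum:
  assumes "finite I" "\<And>i. i \<in> I \<Longrightarrow> f i \<in> function_algebra X"
  shows "(\<lambda>x. \<Sum>i\<in>I. f i x) \<in> function_algebra X"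
  using assms by (induction rule: finite_induct)
    (auto intro: function_algebra.add function_algebra.const)

lemma function_algebra_prod:
  assumes "finite I" "\<And>i. i \<in> I \<Longrightarrow> f i \<in> function_algebra X"
  shows "(\<lambda>x. \<Prod>i\<in>I. f i x) \<in> function_algebra X"
  using assms by (induction rule: finite_induct)
    (auto intro: function_algebra.mult function_algebra.const)

text \<open>By the Leibniz formula. The generality in \<open>M\<close> and \<open>X\<close> covers
  both \<open>det\<close> as a polynomial in the entries and the numerators in Cramer's
  rule.\<close>

lemma function_algebra_det:
  fixes M :: "'a \<Rightarrow> complex^'n^'n"
  assumes "\<And>i j. (\<lambda>x. M x $ i $ j) \<in> function_algebra X"
  shows "(\<lambda>x. det (M x)) \<in> function_algebra X"
  unfolding det_def
  by (intro function_algebra_sum function_algebra.mult function_algebra.const function_algebra_prod assms)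
    (simp_all add: finite_permutations)

abbreviation matrix_entries :: "(complex^'n^'m \<Rightarrow> complex) set"
  where "matrix_entries \<equiv> {f. \<exists>i j. f = (\<lambda>A. A $ i $ j)}"

lemma det_polynomial: "det \<in> function_algebra (matrix_entries :: (complex^'n^'n \<Rightarrow> complex) set)"
  using function_algebra_det[of "\<lambda>A. A :: complex^'n^'n" matrix_entries]
  by (auto intro: function_algebra.gen)

lemma polynomial_regular: "f \<in> function_algebra matrix_entries \<Longrightarrow> f \<in> regular_GL"
  unfolding regular_GL_def by (erule function_algebra_mono[rotated]) blast

lemmas det_regular = polynomial_regular[OF det_polynomial]

lemma regular_GL_intros:
  shows regular_const: "(\<lambda>_. c) \<in> regular_GL"
    and regular_entry: "(\<lambda>A. A $ i $ j) \<in> regular_GL"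
    and regular_inverse_det: "(\<lambda>A. inverse (det A)) \<in> regular_GL"
    and regular_add: "f \<in> regular_GL \<Longrightarrow> g \<in> regular_GL \<Longrightarrow> (\<lambda>A. f A + g A) \<in> regular_GL"
    and regular_mult: "f \<in> regular_GL \<Longrightarrow> g \<in> regular_GL \<Longrightarrow> (\<lambda>A. f A * g A) \<in> regular_GL"
  unfolding regular_GL_def by (auto intro: function_algebra.intros)

lemma regular_sum:
  assumes "finite I" "\<And>i. i \<in> I \<Longrightarrow> f i \<in> regular_GL"
  shows "(\<lambda>A. \<Sum>i\<in>I. f i A) \<in> regular_GL"
  using assms unfolding regular_GL_def by (rule function_algebra_sum)

text \<open>The case of 1/det may assume the property for \<open>det\<close>: an induction over the
  polynomials in the entries, \<open>det\<close> among them, is run first.\<close>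

lemma regular_induct [consumes 1, case_names const entry inverse_det add mult]:
  assumes "f \<in> regular_GL"
    and const: "\<And>c. P (\<lambda>_. c)" and entry: "\<And>i j. P (\<lambda>A. A $ i $ j)"
    and inverse_det: "P det \<Longrightarrow> P (\<lambda>A. inverse (det A))"
    and add: "\<And>f g. f \<in> regular_GL \<Longrightarrow> P f \<Longrightarrow> g \<in> regular_GL \<Longrightarrow> P g \<Longrightarrow> P (\<lambda>A. f A + g A)"
    and mult: "\<And>f g. f \<in> regular_GL \<Longrightarrow> P f \<Longrightarrow> g \<in> regular_GL \<Longrightarrow> P g \<Longrightarrow> P (\<lambda>A. f A * g A)"
  shows "P f"
proof -
  have "P f" if "f \<in> function_algebra matrix_entries" for f
    using that by induction (auto intro: const entry add mult polynomial_regular)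
  then have "P det"
    using det_polynomial by blast
  show ?thesis
    using assms(1)[unfolded regular_GL_def]
  proof induction
    case (gen f)
    then show ?case using entry inverse_det[OF \<open>P det\<close>] by blast
  qed (auto intro: const add mult simp: regular_GL_def)
qed

section \<open>Differentials at the identity and tangent vectors\<close>

definition dir_deriv :: "(complex^'n^'n \<Rightarrow> complex) \<Rightarrow> complex^'n^'n \<Rightarrow> complex"
  where "dir_deriv f X = deriv (\<lambda>z. f (mat 1 + z *\<^sub>M X)) 0"

text \<open>A single functional serves all directions \<open>X\<close>, so linearity in
  \<open>X\<close> comes out of the same induction as differentiability.\<close>

lemma regular_differentiable:
  fixes f :: "complex^'n^'n \<Rightarrow> complex"
  assumes "f \<in> regular_GL"
  shows "\<exists>L. clinear_functional L \<and>
    (\<forall>X. ((\<lambda>z. f (mat 1 + z *\<^sub>M X)) has_field_derivative L X) (at 0))"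
  using assms
proof (induction rule: regular_induct)
  case (const c)
  show ?case by (intro exI[of _ "\<lambda>_. 0"]) (simp add: clinear_functionalI)
next
  case (entry i j)
  show ?case
    by (intro exI[of _ "\<lambda>X. X $ i $ j"] conjI allI clinear_functionalI)
      (auto intro!: derivative_eq_intros)
next
  case inverse_det
  then obtain L where L: "clinear_functional L"
    "\<And>X :: complex^'n^'n. ((\<lambda>z. det (mat 1 + z *\<^sub>M X)) has_field_derivative L X) (at 0)"
    by blast
  show ?case
  proof (intro exI[of _ "\<lambda>X. - L X"] conjI allI)
    show "clinear_functional (\<lambda>X. - L X)"
      by (rule clinear_functionalI)
        (simp_all add: clinear_functional_add[OF L(1)] clinear_functional_scale[OF L(1)])
    \<comment> \<open>The squared denominator in the quotient rule is 1, because
      \<open>det (mat 1) = 1\<close>.\<close>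
    show "((\<lambda>z. inverse (det (mat 1 + z *\<^sub>M X))) has_field_derivative - L X) (at 0)" for X
      using DERIV_inverse_fun[OF L(2)[of X]] by simp
  qed
next
  case (add f g)
  then obtain L M where LM: "clinear_functional L" "clinear_functional M"
    and "\<And>X. ((\<lambda>z. f (mat 1 + z *\<^sub>M X)) has_field_derivative L X) (at 0)"
    "\<And>X. ((\<lambda>z. g (mat 1 + z *\<^sub>M X)) has_field_derivative M X) (at 0)"
    by blast
  then show ?case
    by (intro exI[of _ "\<lambda>X. L X + M X"] conjI allI clinear_functionalI DERIV_add)
      (simp_all add: clinear_functional_add[OF LM(1)] clinear_functional_scale[OF LM(1)]
        clinear_functional_add[OF LM(2)] clinear_functional_scale[OF LM(2)] algebra_simps)
next
  case (mult f g)
  then obtain L M where LM: "clinear_functional L" "clinear_functional M"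
    and deriv: "\<And>X. ((\<lambda>z. f (mat 1 + z *\<^sub>M X)) has_field_derivative L X) (at 0)"
    "\<And>X. ((\<lambda>z. g (mat 1 + z *\<^sub>M X)) has_field_derivative M X) (at 0)"
    by blast
  show ?case
  proof (intro exI[of _ "\<lambda>X. L X * g (mat 1) + M X * f (mat 1)"] conjI allI)
    show "clinear_functional (\<lambda>X. L X * g (mat 1) + M X * f (mat 1))"
      by (rule clinear_functionalI)
        (simp_all add: clinear_functional_add[OF LM(1)] clinear_functional_scale[OF LM(1)]
          clinear_functional_add[OF LM(2)] clinear_functional_scale[OF LM(2)] algebra_simps)
    show "((\<lambda>z. f (mat 1 + z *\<^sub>M X) * g (mat 1 + z *\<^sub>M X)) has_field_derivative
        L X * g (mat 1) + M X * f (mat 1)) (at 0)" for X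
      using DERIV_mult[OF deriv(1)[of X] deriv(2)[of X]] by simp
  qed
qed

lemma dir_deriv:
  assumes "f \<in> regular_GL"
  shows has_dir_deriv: "((\<lambda>z. f (mat 1 + z *\<^sub>M X)) has_field_derivative dir_deriv f X) (at 0)"
    and dir_deriv_linear: "clinear_functional (dir_deriv f)"
proof -
  obtain L where L: "clinear_functional L"
    "\<And>X. ((\<lambda>z. f (mat 1 + z *\<^sub>M X)) has_field_derivative L X) (at 0)"
    using regular_differentiable[OF assms] by blast
  have "dir_deriv f = L"
    unfolding dir_deriv_def by (rule ext, rule DERIV_imp_deriv[OF L(2)])
  then show "((\<lambda>z. f (mat 1 + z *\<^sub>M X)) has_field_derivative dir_deriv f X) (at 0)"
    and "clinear_functional (dir_deriv f)"
    using L by (simp_all only:)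
qed

lemma dir_deriv_const: "dir_deriv (\<lambda>_. c) X = 0"
  by (simp add: dir_deriv_def)

lemma dir_deriv_entry: "dir_deriv (\<lambda>A. A $ i $ j) X = X $ i $ j"
  unfolding dir_deriv_def by (rule DERIV_imp_deriv) (auto intro!: derivative_eq_intros)

lemma dir_deriv_add:
  "f \<in> regular_GL \<Longrightarrow> g \<in> regular_GL \<Longrightarrow> dir_deriv (\<lambda>A. f A + g A) X = dir_deriv f X + dir_deriv g X"
  unfolding dir_deriv_def[of "\<lambda>A. f A + g A"]
  by (rule DERIV_imp_deriv) (intro DERIV_add has_dir_deriv)

lemma dir_deriv_mult:
  assumes "f \<in> regular_GL" "g \<in> regular_GL"
  shows "dir_deriv (\<lambda>A. f A * g A) X = dir_deriv f X * g (mat 1) + f (mat 1) * dir_deriv g X"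
  unfolding dir_deriv_def[of "\<lambda>A. f A * g A"]
  using DERIV_mult[OF has_dir_deriv[OF assms(1), of X] has_dir_deriv[OF assms(2), of X]]
  by (intro DERIV_imp_deriv) (simp add: mult.commute)

lemma dir_deriv_sum:
  assumes "finite I" "\<And>i. i \<in> I \<Longrightarrow> f i \<in> regular_GL"
  shows "dir_deriv (\<lambda>A. \<Sum>i\<in>I. f i A) X = (\<Sum>i\<in>I. dir_deriv (f i) X)"
  using assms by (induction rule: finite_induct)
    (simp_all add: dir_deriv_const dir_deriv_add regular_sum)

lemma Lie_iff: "X \<in> Lie S \<longleftrightarrow> (\<forall>f\<in>regular_GL. (\<forall>A\<in>S. f A = 0) \<longrightarrow> dir_deriv f X = 0)"
proof -
  have "((\<lambda>z. f (mat 1 + z *\<^sub>M X)) has_field_derivative 0) (at 0) \<longleftrightarrow> dir_deriv f X = 0"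
    if "f \<in> regular_GL" for f
    using has_dir_deriv[OF that, of X] DERIV_unique by metis
  then show ?thesis by (auto simp: Lie_def)
qed

lemma Lie_subspace: "cmat.subspace (Lie S)"
  by (rule cmat.subspaceI)
    (simp_all add: Lie_iff clinear_functional_add[OF dir_deriv_linear]
      clinear_functional_scale[OF dir_deriv_linear] cmat_functional.linear_0[OF dir_deriv_linear])

text \<open>By continuity of \<open>det\<close>, the line through the identity stays in GL near 0,
  so a function vanishing on GL is locally 0 along it. Identities valid only for invertible matrices
  can therefore be differentiated in every direction.\<close>

lemma Lie_GL: "(X :: complex^'n^'n) \<in> Lie (carrier GL)"
  unfolding Lie_iff
proof (intro ballI impI)
  fix f :: "complex^'n^'n \<Rightarrow> complex" assume f: "f \<in> regular_GL" "\<forall>A\<in>carrier GL. f A = 0"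
  have "isCont (\<lambda>z. det (mat 1 + z *\<^sub>M X)) 0"
    using has_dir_deriv[OF det_regular] by (rule DERIV_isCont)
  then have "((\<lambda>z. det (mat 1 + z *\<^sub>M X)) \<longlongrightarrow> 1) (nhds 0)"
    using tendsto_at_iff_tendsto_nhds[of "\<lambda>z. det (mat 1 + z *\<^sub>M X)" 0] by (simp add: isCont_def)
  then have "\<forall>\<^sub>F z in nhds 0. det (mat 1 + z *\<^sub>M X) \<noteq> 0"
    by (rule tendsto_imp_eventually_ne) simp
  then have "\<forall>\<^sub>F z in nhds 0. f (mat 1 + z *\<^sub>M X) = 0"
    by eventually_elim (use f in \<open>simp add: GL_def invertible_det_nz\<close>)
  then show "dir_deriv f X = 0"
    unfolding dir_deriv_def using deriv_cong_ev[of "\<lambda>z. f (mat 1 + z *\<^sub>M X)" "\<lambda>_. 0" 0 0] by simp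
qed

text \<open>A tangent vector annihilates the difference, which vanishes on \<open>S\<close>. This is
  how identities that hold only on a group are differentiated.\<close>

lemma dir_deriv_cong:
  assumes "f \<in> regular_GL" "g \<in> regular_GL" "X \<in> Lie S" "\<And>A. A \<in> S \<Longrightarrow> f A = g A"
  shows "dir_deriv f X = dir_deriv g X"
proof -
  let ?d = "\<lambda>A. f A + (-1) * g A"
  have g: "(\<lambda>A. (-1) * g A) \<in> regular_GL" and d: "?d \<in> regular_GL"
    by (intro regular_GL_intros assms)+
  have "dir_deriv ?d X = 0"
    using assms(3,4) d by (simp add: Lie_iff)
  then have "dir_deriv f X + dir_deriv (\<lambda>A. (-1) * g A) X = 0"
    by (simp only: dir_deriv_add[OF assms(1) g])
  then show ?thesis
    by (simp only: dir_deriv_mult[OF regular_const assms(2)] dir_deriv_const) simp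
qed

section \<open>Matrix-valued regular functions and the derivative of inversion\<close>

definition regular_matrix :: "(complex^'n^'n \<Rightarrow> complex^'n^'n) \<Rightarrow> bool"
  where "regular_matrix M \<longleftrightarrow> (\<forall>i j. (\<lambda>A. M A $ i $ j) \<in> regular_GL)"

definition matrix_deriv :: "(complex^'n^'n \<Rightarrow> complex^'n^'n) \<Rightarrow> complex^'n^'n \<Rightarrow> complex^'n^'n"
  where "matrix_deriv M X = (\<chi> i j. dir_deriv (\<lambda>A. M A $ i $ j) X)"

lemma regular_matrix_const: "regular_matrix (\<lambda>_. C)"
  and regular_matrix_id: "regular_matrix (\<lambda>A. A)"
  by (simp_all add: regular_matrix_def regular_GL_intros)

lemma regular_matrix_mult:
  "regular_matrix M \<Longrightarrow> regular_matrix N \<Longrightarrow> regular_matrix (\<lambda>A. M A ** N A)"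
  by (simp add: regular_matrix_def matrix_matrix_mult_def regular_sum regular_mult)

lemma matrix_deriv_const: "matrix_deriv (\<lambda>_. C) X = 0"
  and matrix_deriv_id: "matrix_deriv (\<lambda>A. A) X = X"
  by (simp_all add: matrix_deriv_def vec_eq_iff dir_deriv_const dir_deriv_entry)

lemma matrix_deriv_mult:
  assumes "regular_matrix M" "regular_matrix N"
  shows "matrix_deriv (\<lambda>A. M A ** N A) X = matrix_deriv M X ** N (mat 1) + M (mat 1) ** matrix_deriv N X"
  using assms
  by (simp add: matrix_deriv_def regular_matrix_def matrix_matrix_mult_def vec_eq_iff
      dir_deriv_sum regular_mult dir_deriv_mult sum.distrib)

lemma matrix_deriv_cong:
  assumes "regular_matrix M" "regular_matrix N" "X \<in> Lie S" "\<And>A. A \<in> S \<Longrightarrow> M A = N A"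
  shows "matrix_deriv M X = matrix_deriv N X"
  using assms
  by (auto simp: matrix_deriv_def regular_matrix_def vec_eq_iff intro!: dir_deriv_cong[of _ _ X S])

text \<open>In matrix units, \<open>L\<close> is a combination of the entries with constant
  coefficients. The functional meant is the differential of a regular function, composed with
  conjugation of a tangent vector.\<close>

lemma regular_functional:
  assumes L: "clinear_functional L" and M: "regular_matrix M"
  shows "(\<lambda>A. L (M A)) \<in> regular_GL" and "dir_deriv (\<lambda>A. L (M A)) X = L (matrix_deriv M X)"
proof -
  define c where "c i j = L (matrix_unit i j)" for i j
  have L_expand: "L C = (\<Sum>i\<in>UNIV. \<Sum>j\<in>UNIV. C $ i $ j * c i j)" for C
    using arg_cong[OF matrix_unit_expansion[of C], of L]
    by (simp add: cmat_functional.linear_sum[OF L] clinear_functional_scale[OF L] c_def)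
  have entry: "(\<lambda>A. M A $ i $ j) \<in> regular_GL" for i j
    using M by (simp add: regular_matrix_def)
  have summand: "(\<lambda>A. M A $ i $ j * c i j) \<in> regular_GL" for i j
    by (intro regular_mult entry regular_const)
  have row: "(\<lambda>A. \<Sum>j\<in>UNIV. M A $ i $ j * c i j) \<in> regular_GL" for i
    by (intro regular_sum summand finite)
  show "(\<lambda>A. L (M A)) \<in> regular_GL"
    unfolding L_expand by (intro regular_sum row finite)
  show "dir_deriv (\<lambda>A. L (M A)) X = L (matrix_deriv M X)"
    unfolding L_expand
    by (simp add: dir_deriv_sum summand row dir_deriv_mult entry regular_const dir_deriv_const
        matrix_deriv_def)
qed

text \<open>Unlike \<^const>\<open>matrix_inv\<close>, this form of the inverse has visibly regular entries.\<close>

definition cramer_inverse :: "complex^'n^'n \<Rightarrow> complex^'n^'n"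
  where "cramer_inverse A = (\<chi> k j. det (\<chi> i l. if l = k then mat 1 $ i $ j else A $ i $ l) * inverse (det A))"

text \<open>Column \<open>j\<close> solves the linear system with right-hand side the
  \<open>j\<close>-th unit vector, by Cramer's rule.\<close>

lemma cramer_inverse:
  assumes "A \<in> carrier GL"
  shows "A ** cramer_inverse A = mat 1"
proof -
  have "det A \<noteq> 0" using assms by (simp add: GL_def invertible_det_nz)
  have "A *v column j (cramer_inverse A) = column j (mat 1)" for j
    unfolding cramer[OF \<open>det A \<noteq> 0\<close>]
    by (simp add: cramer_inverse_def column_def divide_inverse cong: if_cong)
  then show ?thesis
    by (simp add: vec_eq_iff matrix_vector_mult_def matrix_matrix_mult_def column_def)
qed

lemma regular_matrix_cramer_inverse: "regular_matrix cramer_inverse"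
proof -
  have "(\<lambda>A. det (\<chi> i l. if l = k then mat 1 $ i $ j else A $ i $ l)) \<in> regular_GL" for k j :: 'a
    unfolding regular_GL_def
  proof (rule function_algebra_det, unfold regular_GL_def[symmetric])
    fix i l :: 'a
    show "(\<lambda>A. (\<chi> i l. if l = k then mat 1 $ i $ j else A $ i $ l) $ i $ l) \<in> regular_GL"
      by (cases "l = k") (simp_all add: regular_GL_intros)
  qed
  then show ?thesis
    by (simp add: regular_matrix_def cramer_inverse_def regular_mult regular_inverse_det)
qed

lemma cramer_inverse_1: "cramer_inverse (mat 1) = mat 1"
  using cramer_inverse[of "mat 1"] group.subgroup_self[OF group_GL]
  by (simp add: GL_def invertible_det_nz)

text \<open>The product rule for \<open>A ** cramer_inverse A = mat 1\<close>, an identity on GL;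
  \<open>Lie_GL\<close> admits every \<open>X\<close>.\<close>

lemma matrix_deriv_cramer_inverse: "matrix_deriv cramer_inverse X = - X"
proof -
  have "matrix_deriv (\<lambda>A. A ** cramer_inverse A) X = matrix_deriv (\<lambda>_. mat 1) X"
    by (rule matrix_deriv_cong[of _ _ X "carrier GL"])
      (simp_all add: regular_matrix_mult regular_matrix_id regular_matrix_const
        regular_matrix_cramer_inverse Lie_GL cramer_inverse)
  then show ?thesis
    by (simp add: matrix_deriv_mult regular_matrix_id regular_matrix_cramer_inverse
        matrix_deriv_id matrix_deriv_const cramer_inverse_1 add_eq_0_iff)
qed

section \<open>Lie algebras of matrix groups\<close>

text \<open>A chain rule: each regular \<open>f\<close> pulls back along \<open>M\<close> to a
  function that agrees on \<open>S\<close> with a regular \<open>h\<close>, and the differential of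
  \<open>h\<close> at \<open>X\<close> is that of \<open>f\<close> at
  \<open>matrix_deriv M X\<close>. If \<open>f\<close> vanishes on \<open>S'\<close>, then
  \<open>h\<close> vanishes on \<open>S\<close>. The function \<open>k\<close> supplies the pullback
  of 1/det.\<close>

lemma Lie_image:
  fixes S S' :: "(complex^'n^'n) set"
  assumes one: "mat 1 \<in> S" "M (mat 1) = mat 1" and M: "regular_matrix M"
    and k: "k \<in> regular_GL" "\<And>A. A \<in> S \<Longrightarrow> k A * det (M A) = 1"
    and image: "\<And>A. A \<in> S \<Longrightarrow> M A \<in> S'" and X: "X \<in> Lie S"
  shows "matrix_deriv M X \<in> Lie S'"
  unfolding Lie_iff
proof (intro ballI impI)
  let ?Y = "matrix_deriv M X"
  fix f :: "complex^'n^'n \<Rightarrow> complex" assume f: "f \<in> regular_GL" "\<forall>A\<in>S'. f A = 0"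
  have "\<exists>h\<in>regular_GL. (\<forall>A\<in>S. h A = f (M A)) \<and> dir_deriv h X = dir_deriv f ?Y"
    using f(1)
  proof (induction rule: regular_induct)
    case (const c)
    show ?case by (rule bexI[of _ "\<lambda>_. c"]) (simp_all add: dir_deriv_const regular_const)
  next
    case (entry i j)
    show ?case
      by (rule bexI[of _ "\<lambda>A. M A $ i $ j"])
        (use M in \<open>simp_all add: dir_deriv_entry matrix_deriv_def regular_matrix_def\<close>)
  next
    case inverse_det
    then obtain h where h: "h \<in> regular_GL" "\<And>A. A \<in> S \<Longrightarrow> h A = det (M A)"
      "dir_deriv h X = dir_deriv det ?Y"
      by blast
    \<comment> \<open>Differentiating \<open>k A * h A = 1\<close> along \<open>S\<close> determines
      the derivative of \<open>k\<close>; the same computation on GL determines that of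
      1/det.\<close>
    have "dir_deriv (\<lambda>A. k A * h A) X = dir_deriv (\<lambda>_. 1) X"
      by (rule dir_deriv_cong[OF _ _ X]) (simp_all add: h k regular_mult regular_const)
    moreover have "h (mat 1) = 1" "k (mat 1) = 1"
      using k(2)[OF one(1)] h(2)[OF one(1)] one(2) by simp_all
    ultimately have "dir_deriv k X = - dir_deriv det ?Y"
      by (simp add: dir_deriv_mult k h dir_deriv_const add_eq_0_iff2)
    moreover have "dir_deriv (\<lambda>A. inverse (det A) * det A) ?Y = dir_deriv (\<lambda>_. 1) ?Y"
      by (rule dir_deriv_cong[OF _ _ Lie_GL])
        (simp_all add: det_regular regular_GL_intros GL_def invertible_det_nz)
    then have "dir_deriv (\<lambda>A. inverse (det A)) ?Y = - dir_deriv det ?Y"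
      by (simp add: dir_deriv_mult det_regular regular_inverse_det dir_deriv_const add_eq_0_iff2)
    moreover have "k A = inverse (det (M A))" if "A \<in> S" for A
      using k(2)[OF that] by (metis inverse_unique mult.commute)
    ultimately show ?case using k(1) by auto
  next
    case (add f g)
    then obtain h h' where "h \<in> regular_GL" "\<forall>A\<in>S. h A = f (M A)" "dir_deriv h X = dir_deriv f ?Y"
      "h' \<in> regular_GL" "\<forall>A\<in>S. h' A = g (M A)" "dir_deriv h' X = dir_deriv g ?Y"
      by blast
    then show ?case using add.hyps
      by (intro bexI[of _ "\<lambda>A. h A + h' A"]) (simp_all add: dir_deriv_add regular_add)
  next
    case (mult f g)
    then obtain h h' where "h \<in> regular_GL" "\<forall>A\<in>S. h A = f (M A)" "dir_deriv h X = dir_deriv f ?Y"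
      "h' \<in> regular_GL" "\<forall>A\<in>S. h' A = g (M A)" "dir_deriv h' X = dir_deriv g ?Y"
      by blast
    \<comment> \<open>The product rule involves values at the identity, and \<open>one\<close> makes
      those of \<open>h\<close> and \<open>h'\<close> equal to those of \<open>f\<close> and
      \<open>g\<close>.\<close>
    then show ?case using mult.hyps one
      by (intro bexI[of _ "\<lambda>A. h A * h' A"]) (simp_all add: dir_deriv_mult regular_mult)
  qed
  then obtain h where h: "h \<in> regular_GL" "\<forall>A\<in>S. h A = f (M A)" "dir_deriv h X = dir_deriv f ?Y"
    by blast
  then have "dir_deriv h X = 0"
    using X f(2) image by (simp add: Lie_iff)
  then show "dir_deriv f ?Y = 0"
    using h by simp
qed

text \<open>Differentiate \<open>a ** b = b ** a\<close> in \<open>a\<close> for fixed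
  \<open>b\<close>, and the resulting \<open>X ** b = b ** X\<close> in \<open>b\<close>.\<close>

lemma Lie_commute:
  assumes "\<And>a b. a \<in> S \<Longrightarrow> b \<in> S' \<Longrightarrow> a ** b = b ** a" "X \<in> Lie S" "Y \<in> Lie S'"
  shows "commutator X Y = 0"
proof -
  have "X ** b = b ** X" if "b \<in> S'" for b
  proof -
    have "matrix_deriv (\<lambda>A. A ** b) X = matrix_deriv (\<lambda>A. b ** A) X"
      by (rule matrix_deriv_cong[OF _ _ assms(2)])
        (simp_all add: regular_matrix_mult regular_matrix_id regular_matrix_const assms(1)[OF _ that])
    then show ?thesis
      by (simp add: regular_matrix_id regular_matrix_const matrix_deriv_mult
        matrix_deriv_id matrix_deriv_const)
  qed
  then have "matrix_deriv (\<lambda>A. X ** A) Y = matrix_deriv (\<lambda>A. A ** X) Y"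
    by (intro matrix_deriv_cong[OF _ _ assms(3)])
      (simp_all add: regular_matrix_mult regular_matrix_id regular_matrix_const)
  then have "X ** Y = Y ** X"
    by (simp add: regular_matrix_id regular_matrix_const matrix_deriv_mult
        matrix_deriv_id matrix_deriv_const)
  then show ?thesis by (simp add: commutator_def)
qed

text \<open>Conjugation by an element of \<open>U\<close> maps \<open>U\<close> to itself and fixes
  the identity, so by \<open>Lie_image\<close> its derivative preserves \<open>Lie U\<close>. The
  commutator then appears on differentiating once more, in the conjugating element.\<close>

lemma Lie_commutator:
  fixes U :: "(complex^'n^'n) set"
  assumes U: "subgroup U GL" and X: "X \<in> Lie U" and Y: "Y \<in> Lie U"
  shows "commutator X Y \<in> Lie U"
  unfolding Lie_iff
proof (intro ballI impI)
  fix f :: "complex^'n^'n \<Rightarrow> complex" assume f: "f \<in> regular_GL" "\<forall>A\<in>U. f A = 0"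
  have one: "mat 1 \<in> U"
    using subgroup.one_closed[OF U] by (simp add: GL_def)
  have conj: "A ** Y ** cramer_inverse A \<in> Lie U" if "A \<in> U" for A
  proof -
    have A: "A \<in> carrier GL" using subgroup.mem_carrier[OF U that] .
    then have AJ: "A ** cramer_inverse A = mat 1" by (rule cramer_inverse)
    \<comment> \<open>\<open>cramer_inverse A\<close> is the group inverse, as a left and a right
      inverse of \<open>A\<close> coincide.\<close>
    have J: "cramer_inverse A \<in> U"
    proof -
      have "inv\<^bsub>GL\<^esub> A \<in> U" using subgroup.m_inv_closed[OF U that] .
      moreover have "inv\<^bsub>GL\<^esub> A ** A = mat 1"
        using group.l_inv[OF group_GL A] by (simp add: GL_def)
      then have "inv\<^bsub>GL\<^esub> A = cramer_inverse A"
        by (metis AJ matrix_mul_assoc matrix_mul_lid matrix_mul_rid)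
      ultimately show ?thesis by simp
    qed
    have closed: "a ** b \<in> U" if "a \<in> U" "b \<in> U" for a b
      using subgroup.m_closed[OF U that] by (simp add: GL_def)
    let ?M = "\<lambda>C. A ** C ** cramer_inverse A"
    \<comment> \<open>Conjugation preserves the determinant, so 1/det can play the role of
      \<open>k\<close> in \<open>Lie_image\<close>.\<close>
    have det: "det (?M C) = det C" for C
    proof -
      have "det A * det (cramer_inverse A) = 1" using AJ by (metis det_I det_mul)
      then show ?thesis by (simp add: det_mul mult_ac)
    qed
    have "matrix_deriv ?M Y \<in> Lie U"
    proof (rule Lie_image[OF one _ _ regular_inverse_det _ _ Y])
      show "regular_matrix ?M"
        by (simp add: regular_matrix_mult regular_matrix_id regular_matrix_const)
      show "inverse (det C) * det (?M C) = 1" if "C \<in> U" for C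
        using subgroup.mem_carrier[OF U that] by (simp add: det GL_def invertible_det_nz)
    qed (use \<open>A \<in> U\<close> J closed AJ in auto)
    then show ?thesis
      by (simp add: regular_matrix_mult regular_matrix_id regular_matrix_const matrix_deriv_mult
        matrix_deriv_id matrix_deriv_const)
  qed
  \<comment> \<open>The derivative of \<open>A \<mapsto> df(A Y A\<^sup>-\<^sup>1)\<close>, which vanishes on \<open>U\<close>, in direction \<open>X\<close> is \<open>df([X, Y])\<close>.\<close>
  let ?h = "\<lambda>A. dir_deriv f (A ** Y ** cramer_inverse A)"
  have M: "regular_matrix (\<lambda>A. A ** Y ** cramer_inverse A)"
    by (simp add: regular_matrix_mult regular_matrix_id regular_matrix_const regular_matrix_cramer_inverse)
  have "dir_deriv ?h X = 0"
    using X f conj regular_functional(1)[OF dir_deriv_linear[OF f(1)] M] by (simp add: Lie_iff)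
  moreover have "Y ** - X = - (Y ** X)"
    using mult_cscale_right[of Y "-1" X] by (simp only: cscale_minus1)
  then have "matrix_deriv (\<lambda>A. A ** Y ** cramer_inverse A) X = commutator X Y"
    by (simp add: matrix_deriv_mult regular_matrix_mult regular_matrix_id regular_matrix_const
        regular_matrix_cramer_inverse matrix_deriv_cramer_inverse matrix_deriv_id matrix_deriv_const
        cramer_inverse_1 commutator_def)
  ultimately show "dir_deriv f (commutator X Y) = 0"
    by (simp add: regular_functional(2)[OF dir_deriv_linear[OF f(1)] M])
qed


text \<open>A \<open>regular_map\<close> only provides regular functions that agree with pullbacks
  on \<open>S\<close>. Those for the matrix entries assemble to \<open>M\<close>, which can be
  differentiated, and the one for 1/det is the \<open>k\<close> of \<open>Lie_image\<close>.\<close>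

lemma Lie_regular_map:
  fixes \<phi> :: "complex^'n^'n \<Rightarrow> complex^'n^'n"
  assumes \<phi>: "regular_map S regular_GL regular_GL \<phi>" and one: "mat 1 \<in> S" "\<phi> (mat 1) = mat 1"
    and image: "\<And>A. A \<in> S \<Longrightarrow> \<phi> A \<in> S'" and S': "S' \<subseteq> carrier GL"
  obtains M where "regular_matrix M" "\<And>A. A \<in> S \<Longrightarrow> M A = \<phi> A"
    "\<And>X. X \<in> Lie S \<Longrightarrow> matrix_deriv M X \<in> Lie S'"
proof -
  have "\<exists>g\<in>regular_GL. \<forall>A\<in>S. \<phi> A $ i $ j = g A" for i j
    using bspec[OF \<phi>[unfolded regular_map_def] regular_entry[of i j]] .
  then obtain g where g: "\<And>i j. g i j \<in> regular_GL" "\<And>i j A. A \<in> S \<Longrightarrow> \<phi> A $ i $ j = g i j A"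
    by metis
  define M where "M A = (\<chi> i j. g i j A)" for A
  have M: "regular_matrix M" "\<And>A. A \<in> S \<Longrightarrow> M A = \<phi> A"
    using g by (simp_all add: regular_matrix_def M_def vec_eq_iff)
  obtain k where k: "k \<in> regular_GL" "\<And>A. A \<in> S \<Longrightarrow> inverse (det (\<phi> A)) = k A"
    using bspec[OF \<phi>[unfolded regular_map_def] regular_inverse_det] by blast
  \<comment> \<open>Invertibility of the elements of \<open>S'\<close> is essential here, since
    \<open>inverse 0\<close> is 0.\<close>
  have "k A * det (M A) = 1" if "A \<in> S" for A
    using image[OF that] S' k(2)[OF that, symmetric] that by (auto simp: M GL_def invertible_det_nz)
  then have "matrix_deriv M X \<in> Lie S'" if "X \<in> Lie S" for X
    using Lie_image[OF one(1) _ M(1) k(1) _ _ that] M one image by simp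
  with M show thesis by (rule that)
qed

section \<open>Commutativity of tori and Lie algebras of direct products\<close>

lemma torus_commute:
  assumes "torus T" "a \<in> T" "b \<in> T"
  shows "a ** b = b ** a"
proof -
  have T: "subgroup T GL"
    using assms by (simp add: torus_def linear_algebraic_group_def)
  obtain k \<phi> where \<phi>: "\<phi> \<in> iso (matrix_group T) (Gm k)"
    using assms(1) by (auto simp: torus_def)
  have "\<phi> (a ** b) = \<phi> (b ** a)"
    using \<phi> assms(2,3) by (simp add: iso_def hom_def GL_def Gm_def mult.commute)
  moreover have "a ** b \<in> T" "b ** a \<in> T"
    using subgroup.m_closed[OF T] assms(2,3) by (simp_all add: GL_def)
  moreover have "inj_on \<phi> T"
    using \<phi> by (simp add: iso_def bij_betw_def)
  ultimately show ?thesis by (meson inj_onD)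
qed

text \<open>In the direct product, the pairs (1, u) and (t, 1) multiply to (t, u). Their images
  multiply to \<open>u ** t\<close>, and that of the product is \<open>t ** u\<close>.\<close>

lemma direct_product_commute:
  assumes "direct_product_group G T U" "t \<in> T" "u \<in> U"
  shows "t ** u = u ** t"
proof -
  have one: "mat 1 \<in> T" "mat 1 \<in> U"
    using assms(1) subgroup.one_closed[of _ GL]
    by (auto simp: direct_product_group_def linear_algebraic_group_def GL_def)
  have "(\<lambda>(t, u). t ** u) \<in> hom (matrix_group T \<times>\<times> matrix_group U) (matrix_group G)"
    using assms(1) by (simp add: direct_product_group_def iso_def)
  from hom_mult[OF this, of "(mat 1, u)" "(t, mat 1)"] show ?thesis
    using one assms(2,3) by (simp add: GL_def mult_DirProd)
qed

text \<open>Let \<open>M\<close> and \<open>N\<close> represent the two projections of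
  \<open>G\<close>. Differentiating \<open>M A ** N A = A\<close> at the identity splits
  \<open>Lie G\<close>. On \<open>T\<close> the map \<open>M\<close> is the identity and on
  \<open>U\<close> it is constant, so a common tangent vector \<open>X\<close> satisfies
  \<open>X = matrix_deriv M X = 0\<close>.\<close>

lemma Lie_direct_product:
  fixes G T U :: "(complex^'n^'n) set"
  assumes "direct_product_group G T U"
  shows Lie_direct_product_sum: "Lie G \<subseteq> {X + Y | X Y. X \<in> Lie T \<and> Y \<in> Lie U}"
    and Lie_direct_product_Int: "Lie T \<inter> Lie U \<subseteq> {0}"
proof -
  define m :: "(complex^'n^'n) \<times> (complex^'n^'n) \<Rightarrow> complex^'n^'n" where "m = (\<lambda>(t, u). t ** u)"
  have m: "bij_betw m (T \<times> U) G"
    and reg: "regular_map G regular_GL regular_GL (fst \<circ> inv_into (T \<times> U) m)"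
      "regular_map G regular_GL regular_GL (snd \<circ> inv_into (T \<times> U) m)"
    using assms by (simp_all add: direct_product_group_def iso_def m_def)
  have one: "mat 1 \<in> T" "mat 1 \<in> U" "mat 1 \<in> G" and sub: "T \<subseteq> carrier GL" "U \<subseteq> carrier GL"
    using assms subgroup.one_closed[of _ GL] subgroup.subset[of _ GL]
    by (auto simp: direct_product_group_def linear_algebraic_group_def GL_def)
  have inv: "inv_into (T \<times> U) m (t ** u) = (t, u)" if "t \<in> T" "u \<in> U" for t u
    using bij_betw_inv_into_left[OF m, of "(t, u)"] that by (simp add: m_def)
  have prod: "\<exists>t\<in>T. \<exists>u\<in>U. A = t ** u" if "A \<in> G" for A
    using m that by (auto simp: bij_betw_def m_def)
  have inv1: "inv_into (T \<times> U) m (mat 1) = (mat 1, mat 1)"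
    using inv[OF one(1,2)] by simp
  have mem: "(fst \<circ> inv_into (T \<times> U) m) A \<in> T" "(snd \<circ> inv_into (T \<times> U) m) A \<in> U" if "A \<in> G" for A
    using prod[OF that] inv by auto
  obtain M where M: "regular_matrix M" "\<And>A. A \<in> G \<Longrightarrow> M A = (fst \<circ> inv_into (T \<times> U) m) A"
    "\<And>X. X \<in> Lie G \<Longrightarrow> matrix_deriv M X \<in> Lie T"
    using Lie_regular_map[OF reg(1) one(3) _ mem(1) sub(1)] inv1 by auto
  obtain N where N: "regular_matrix N" "\<And>A. A \<in> G \<Longrightarrow> N A = (snd \<circ> inv_into (T \<times> U) m) A"
    "\<And>X. X \<in> Lie G \<Longrightarrow> matrix_deriv N X \<in> Lie U"
    using Lie_regular_map[OF reg(2) one(3) _ mem(2) sub(2)] inv1 by auto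
  have MN1: "M (mat 1) = mat 1" "N (mat 1) = mat 1"
    using M(2)[OF one(3)] N(2)[OF one(3)] inv1 by simp_all
  show "Lie G \<subseteq> {X + Y | X Y. X \<in> Lie T \<and> Y \<in> Lie U}"
  proof
    fix X assume X: "X \<in> Lie G"
    have "M A ** N A = A" if "A \<in> G" for A
      using prod[OF that] M(2)[OF that] N(2)[OF that] inv by auto
    then have "matrix_deriv (\<lambda>A. M A ** N A) X = matrix_deriv (\<lambda>A. A) X"
      by (intro matrix_deriv_cong[OF _ _ X] regular_matrix_mult regular_matrix_id M N)
    then have "X = matrix_deriv M X + matrix_deriv N X"
      by (simp add: matrix_deriv_mult M N MN1 matrix_deriv_id)
    then show "X \<in> {X + Y | X Y. X \<in> Lie T \<and> Y \<in> Lie U}"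
      using M(3)[OF X] N(3)[OF X] by blast
  qed
  show "Lie T \<inter> Lie U \<subseteq> {0}"
  proof
    fix X assume X: "X \<in> Lie T \<inter> Lie U"
    have mem: "t ** u \<in> G" if "t \<in> T" "u \<in> U" for t u
      using bij_betwE[OF m] that by (auto simp: m_def)
    have "M t = t" if "t \<in> T" for t
      using M(2)[OF mem[OF that one(2)]] inv[OF that one(2)] by simp
    then have "matrix_deriv M X = matrix_deriv (\<lambda>A. A) X"
      using X by (intro matrix_deriv_cong[OF M(1) regular_matrix_id, of _ T]) auto
    moreover have "M u = mat 1" if "u \<in> U" for u
      using M(2)[OF mem[OF one(1) that]] inv[OF one(1) that] by simp
    then have "matrix_deriv M X = matrix_deriv (\<lambda>_. mat 1) X"
      using X by (intro matrix_deriv_cong[OF M(1) regular_matrix_const, of _ U]) auto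
    ultimately show "X \<in> {0}"
      by (simp add: matrix_deriv_id matrix_deriv_const)
  qed
qed

theorem proposition5p4:
  fixes G T U :: "(complex^'n::finite^'n) set"
    and B :: "(complex^'n::finite^'n) set"
    and \<rho> :: "complex^('n::finite \<times> 'n)^('n \<times> 'n)"
  assumes "linear_algebraic_group G" and "zariski_connected G"
    and "nilpotent_group (matrix_group G)"
    and "torus T" and "unipotent_group U" and "direct_product_group G T U"
    and "cmat.independent B" and "cmat.span B = Lie T"
    and "CYBE_solution (Lie G) \<rho>"
  shows "\<exists>s r u w.
    s \<in> wedge2 (Lie T) \<and>
    CYBE_solution (Lie U) r \<and>
    (\<forall>b\<in>B. u b \<in> Lie U) \<and>
    w = (\<Sum>b\<in>B. b \<otimes>\<^sub>K u b) \<and>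
    (\<forall>b\<in>B. commutator (u b \<otimes>\<^sub>K mat 1 + mat 1 \<otimes>\<^sub>K u b) r = 0) \<and>
    \<rho> = s + (w - tensor_flip w) + r"
proof -
  have "subgroup U GL"
    using assms(6) by (simp add: direct_product_group_def linear_algebraic_group_def)
  then have comm_U: "commutator X Y \<in> Lie U" if "X \<in> Lie U" "Y \<in> Lie U" for X Y
    using that by (rule Lie_commutator)
  have comm_T: "commutator X Y = 0" if "X \<in> Lie T" "Y \<in> Lie T" for X Y
    using torus_commute[OF assms(4)] that by (rule Lie_commute)
  have comm_TU: "commutator X Y = 0" if "X \<in> Lie T" "Y \<in> Lie U" for X Y
    using direct_product_commute[OF assms(6)] that by (rule Lie_commute)
  \<comment> \<open>\<open>CYBE_decomposition\<close> is applied with \<open>Lie G\<close> for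
    \<open>V\<close> and \<open>Lie U\<close> for \<open>u\<close>; unfolding the spanning
    assumption turns \<open>cmat.span B\<close> into \<open>Lie T\<close>.\<close>
  show ?thesis
    using CYBE_decomposition[OF assms(7) Lie_subspace, of U "Lie G" \<rho>, unfolded assms(8)]
      Lie_direct_product[OF assms(6)] comm_T comm_TU comm_U assms(9) by blast
qed

end
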